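(* Let $M$ be a connected gridding matrix, and let $\Gamma_M=(\gamma_{i,j})$ be the unique maximal $M$-distribution matrix. For each $n$, let $\boldsymbol\sigma^\#$ be drawn uniformly at random from $\mathrm{Grid}^\#_n(M)$, and let $\boldsymbol\sigma^\#_{(i,j)}$ be the number of points of $\boldsymbol\sigma^\#$ in cell $(i,j)$. Then for any $\varepsilon>0$, $$\lim_{n\to\infty}\mathbb{P}\Big[\max_{i,j}\big|\boldsymbol\sigma^\#_{(i,j)}/n-\gamma_{i,j}\big|\leq\varepsilon\Big]=1.$$
   Context: A permutation of length $n$ is identified with its plot $\{(i,\sigma_i)\}$. A gridding matrix $M$ is a matrix each of whose entries (cells) is "increasing", "decreasing" or "blank". Suppose $M$ has $t$ columns (numbered left to right) and $u$ rows (numbered bottom to top). An $M$-gridding of a permutation $\sigma$ of length $n$ is a pair of integer sequences $0=c_0\leq c_1\leq\dots\leq c_t=n$ (column dividers) and $0=r_0\leq r_1\leq\dots\leq r_u=n$ (row dividers) such that for every column and row, say the $a$th column and $b$th row, the subsequence of $\sigma$ with indices in $(c_{a-1},c_a]$ and values in $(r_{b-1},r_b]$ (the points in that cell) is increasing, decreasing or empty according to whether the corresponding entry of $M$ is increasing, decreasing or blank. An $M$-gridded permutation is a permutation together with one of its $M$-griddings; $\mathrm{Grid}^\#_n(M)$ is the set of $M$-gridded permutations of length $n$. The cell graph of $M$ has the non-blank cells as vertices, two being adjacent if they share a row or a column and all the cells between them are blank. $M$ is connected if its cell graph is connected. An $M$-distribution matrix is a nonnegative real matrix $\Gamma=(\gamma_{i,j})$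 of the same dimensions as $M$ (with entries in corresponding positions), with $\gamma_{i,j}=0$ whenever $M_{i,j}$ is blank, and with entries summing to $1$. With row sums $\rho_i=\sum_j\gamma_{i,j}$ and column sums $\kappa_j=\sum_i\gamma_{i,j}$, let $$g(\Gamma)=\prod_i\frac{\rho_i^{\rho_i}}{\prod_j\gamma_{i,j}^{\gamma_{i,j}}}\times\prod_j\frac{\kappa_j^{\kappa_j}}{\prod_i\gamma_{i,j}^{\gamma_{i,j}}},$$ where the products in the denominators are over nonzero entries only (and $0^0=1$). A maximal $M$-distribution matrix is an $M$-distribution matrix for which $g(\Gamma)$ is greatest among all $M$-distribution matrices; when $M$ is connected there is exactly one, denoted $\Gamma_M$. *)

theory Defs
  imports
    "HOL-Probability.Probability_Mass_Function"
    "HOL-Combinatorics.Permutations"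
    "Graph_Theory.Digraph_Component"
    "Jordan_Normal_Form.Matrix"
begin

text \<open>
  Matrix positions are written \<open>(i, j)\<close> with \<open>i\<close> the row and \<open>j\<close> the column, both counted from
  \<open>0\<close>; row \<open>0\<close> is the bottom row and column \<open>0\<close> the leftmost one.
\<close>

datatype cell = Increasing | Decreasing | Blank

type_synonym gridding_matrix = "cell mat"

definition positions :: "'a mat \<Rightarrow> (nat \<times> nat) set" where
  "positions A = {..<dim_row A} \<times> {..<dim_col A}"

section \<open>The cell graph\<close>

definition nonblank_cells :: "gridding_matrix \<Rightarrow> (nat \<times> nat) set" where
  "nonblank_cells M = {p \<in> positions M. M $$ p \<noteq> Blank}"

definition cell_adjacent :: "gridding_matrix \<Rightarrow> nat \<times> nat \<Rightarrow> nat \<times> nat \<Rightarrow> bool" where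
  "cell_adjacent M = (\<lambda>(i, j) (i', j').
     i = i' \<and> j \<noteq> j' \<and> (\<forall>k \<in> {min j j'<..<max j j'}. M $$ (i, k) = Blank) \<or>
     j = j' \<and> i \<noteq> i' \<and> (\<forall>k \<in> {min i i'<..<max i i'}. M $$ (k, j) = Blank))"

definition cell_graph :: "gridding_matrix \<Rightarrow> (nat \<times> nat) pair_pre_digraph" where
  "cell_graph M =
     \<lparr>pverts = nonblank_cells M,
      parcs = {(p, q) \<in> nonblank_cells M \<times> nonblank_cells M. cell_adjacent M p q}\<rparr>"

text \<open>\<open>Digraph_Component.connected\<close> requires at least one vertex, so a matrix with no
  non-blank cell is not connected. (The qualifier separates it from topological connectedness.)\<close>

definition connected_gridding_matrix :: "gridding_matrix \<Rightarrow> bool" where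
  "connected_gridding_matrix M \<longleftrightarrow> Digraph_Component.connected (with_proj (cell_graph M))"

section \<open>Gridded permutations\<close>

text \<open>A permutation of length \<open>n\<close> is a function with \<open>\<sigma> permutes {1..n}\<close>. Dividers are lists
  \<open>[d\<^sub>0, \<dots>, d\<^sub>m]\<close>. A gridded permutation is a triple \<open>(\<sigma>, c, r)\<close> of a permutation,
  its column dividers and its row dividers.\<close>

type_synonym gridded_permutation = "(nat \<Rightarrow> nat) \<times> nat list \<times> nat list"

definition dividers :: "nat \<Rightarrow> nat \<Rightarrow> nat list \<Rightarrow> bool" where
  "dividers m n d \<longleftrightarrow> length d = Suc m \<and> sorted d \<and> d ! 0 = 0 \<and> d ! m = n"

text \<open>The points of a cell are represented by their indices. The point \<open>(k, \<sigma> k)\<close> lies in the cell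
  in row \<open>i\<close> and column \<open>j\<close> (counted from \<open>0\<close>) if \<open>k \<in> (c\<^sub>j, c\<^sub>j\<^sub>+\<^sub>1]\<close> and \<open>\<sigma> k \<in> (r\<^sub>i, r\<^sub>i\<^sub>+\<^sub>1]\<close>.\<close>

fun cell_points :: "gridded_permutation \<Rightarrow> nat \<times> nat \<Rightarrow> nat set" where
  "cell_points (\<sigma>, c, r) (i, j) =
     {k \<in> {c ! j<..c ! Suc j}. \<sigma> k \<in> {r ! i<..r ! Suc i}}"

fun fits_cell :: "cell \<Rightarrow> (nat \<Rightarrow> nat) \<Rightarrow> nat set \<Rightarrow> bool" where
  "fits_cell Increasing \<sigma> S \<longleftrightarrow> strict_mono_on S \<sigma>"
| "fits_cell Decreasing \<sigma> S \<longleftrightarrow> strict_antimono_on S \<sigma>"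
| "fits_cell Blank \<sigma> S \<longleftrightarrow> S = {}"

definition gridded_permutations :: "gridding_matrix \<Rightarrow> nat \<Rightarrow> gridded_permutation set" where
  "gridded_permutations M n =
     {(\<sigma>, c, r). \<sigma> permutes {1..n} \<and> dividers (dim_col M) n c \<and> dividers (dim_row M) n r \<and>
        (\<forall>p \<in> positions M. fits_cell (M $$ p) \<sigma> (cell_points (\<sigma>, c, r) p))}"

text \<open>The next two lemmas show that the uniform distribution \<open>pmf_of_set\<close> on the gridded
  permutations of length \<open>n\<close> is meaningful.\<close>

lemma finite_gridded_permutations: "finite (gridded_permutations M n)"
proof (rule finite_subset)
  let ?D = "\<lambda>m. {d. set d \<subseteq> {..n} \<and> length d = Suc m}"
  have D: "d \<in> ?D m" if "dividers m n d" for m d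
    using that by (auto simp: dividers_def in_set_conv_nth sorted_iff_nth_mono less_Suc_eq_le)
  show "gridded_permutations M n \<subseteq> {\<sigma>. \<sigma> permutes {1..n}} \<times> ?D (dim_col M) \<times> ?D (dim_row M)"
    using D by (auto simp: gridded_permutations_def)
  show "finite ({\<sigma>. \<sigma> permutes {1..n}} \<times> ?D (dim_col M) \<times> ?D (dim_row M))"
    by (intro finite_cartesian_product finite_permutations finite_lists_length_eq) auto
qed

lemma gridded_permutations_nonempty:
  assumes "connected_gridding_matrix M"
  shows "gridded_permutations M n \<noteq> {}"
proof -
  obtain i j where ij: "i < dim_row M" "j < dim_col M" "M $$ (i, j) \<noteq> Blank"
    using assms
    by (auto simp: connected_gridding_matrix_def connected_def strongly_connected_def
        cell_graph_def nonblank_cells_def positions_def)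
  define d where "d = (\<lambda>m a. map (\<lambda>k. if k \<le> a then 0 else n) [0..<Suc m])"
  have nth: "d m a ! k = (if k \<le> a then 0 else n)" if "k \<le> m" for m a k
    using that unfolding d_def by (subst nth_map) (auto simp del: upt_Suc)
  have div: "dividers m n (d m a)" if "a < m" for m a
    using that nth[of _ m a]
    by (auto simp: dividers_def sorted_iff_nth_mono) (auto simp: d_def)
  define \<sigma> where
    "\<sigma> = (\<lambda>k. if M $$ (i, j) = Decreasing \<and> k \<in> {1..n} then Suc n - k else k)"
  have "\<sigma> permutes {1..n}"
    by (rule bij_imp_permutes, rule bij_betw_byWitness[where f' = \<sigma>]) (auto simp: \<sigma>_def)
  moreover have "fits_cell (M $$ (i', j')) \<sigma> (cell_points (\<sigma>, d (dim_col M) j, d (dim_row M) i) (i', j'))"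
    if "i' < dim_row M" "j' < dim_col M" for i' j'
  proof (cases "i' = i \<and> j' = j")
    case True
    then show ?thesis
      using ij by (cases "M $$ (i, j)") (auto simp: nth monotone_on_def \<sigma>_def)
  next
    case False
    then have "cell_points (\<sigma>, d (dim_col M) j, d (dim_row M) i) (i', j') = {}"
      using that by (auto simp: nth split: if_splits)
    then show ?thesis
      by (cases "M $$ (i', j')") (auto simp: monotone_on_def)
  qed
  ultimately have "(\<sigma>, d (dim_col M) j, d (dim_row M) i) \<in> gridded_permutations M n"
    using ij div by (auto simp: gridded_permutations_def positions_def)
  then show ?thesis by blast
qed

section \<open>Distribution matrices\<close>

definition distribution_matrix :: "gridding_matrix \<Rightarrow> real mat \<Rightarrow> bool" where
  "distribution_matrix M \<Gamma> \<longleftrightarrow>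
     \<Gamma> \<in> carrier_mat (dim_row M) (dim_col M) \<and>
     (\<forall>p \<in> positions M. \<Gamma> $$ p \<ge> 0 \<and> (M $$ p = Blank \<longrightarrow> \<Gamma> $$ p = 0)) \<and>
     (\<Sum>p \<in> positions M. \<Gamma> $$ p) = 1"

definition row_sum :: "real mat \<Rightarrow> nat \<Rightarrow> real" where
  "row_sum \<Gamma> i = (\<Sum>j<dim_col \<Gamma>. \<Gamma> $$ (i, j))"

definition col_sum :: "real mat \<Rightarrow> nat \<Rightarrow> real" where
  "col_sum \<Gamma> j = (\<Sum>i<dim_row \<Gamma>. \<Gamma> $$ (i, j))"

text \<open>\<open>x\<^sup>x\<close> with \<open>0\<^sup>0 = 1\<close>; the library has \<open>0 powr 0 = 0\<close>.\<close>

definition self_powr :: "real \<Rightarrow> real" where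
  "self_powr x = (if x = 0 then 1 else x powr x)"

definition growth :: "real mat \<Rightarrow> real" where
  "growth \<Gamma> =
     (\<Prod>i<dim_row \<Gamma>. self_powr (row_sum \<Gamma> i) /
        (\<Prod>j \<in> {j. j < dim_col \<Gamma> \<and> \<Gamma> $$ (i, j) \<noteq> 0}. self_powr (\<Gamma> $$ (i, j)))) *
     (\<Prod>j<dim_col \<Gamma>. self_powr (col_sum \<Gamma> j) /
        (\<Prod>i \<in> {i. i < dim_row \<Gamma> \<and> \<Gamma> $$ (i, j) \<noteq> 0}. self_powr (\<Gamma> $$ (i, j))))"

definition maximal_distribution_matrix :: "gridding_matrix \<Rightarrow> real mat \<Rightarrow> bool" where
  "maximal_distribution_matrix M \<Gamma> \<longleftrightarrow>
     distribution_matrix M \<Gamma> \<and> (\<forall>\<Delta>. distribution_matrix M \<Delta> \<longrightarrow> growth \<Delta> \<le> growth \<Gamma>)"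

end

theory Submission
  imports Defs "HOL-Real_Asymp.Real_Asymp"
begin

text \<open>
  Fix the number \<open>A p\<close> of points in every cell \<open>p\<close>. This fixes the dividers. What remains is to
  choose, for every column, the order in which its points visit the rows when they are read from left
  to right, and for every row the order in which its points visit the columns when they are read
  upwards. These words can be chosen independently, and they determine the permutation since every
  cell is monotone. So the number of gridded permutations with cell counts \<open>A\<close> is a product of
  multinomial coefficients, one for each row and each column (\<open>card_gridded_with_counts\<close>). By
  Stirling's estimate it is \<open>exp (n * G (A / n))\<close> up to a factor polynomial in \<open>n\<close>
  (\<open>card_gridded_with_counts_bounds\<close>), where \<open>G = ln growth\<close> is a sum of entropies, one for each line.

  There are only polynomially many choices of \<open>A\<close>. Hence it suffices that \<open>G\<close> stays below its
  maximum by a constant on all distributions that deviate from \<open>\<Gamma>\<close> by more than \<open>\<epsilon>\<close> in some cell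
  (\<open>growth_gap\<close>), while rounding \<open>n \<Gamma>\<close> to integers produces counts \<open>A\<close> with \<open>G (A / n)\<close> tending to
  the maximum (\<open>integer_approximation\<close>). The deviating gridded permutations are then an exponentially
  small proportion of all.

  By compactness and continuity, the gap follows from the uniqueness of the maximizer
  (\<open>maximal_distribution_unique\<close>). The function \<open>G\<close> is homogeneous of degree 1 and superadditive, and it is
  additive on a pair of distributions only if they are proportional along every row and every column
  (\<open>log_growth_superadditive\<close>). Two maximizers must be such a pair. Both are positive on all non-blank
  cells (\<open>maximal_distribution_pos\<close>), so their ratio is a constant on every line and, as the cell
  graph is connected, the same constant everywhere.
\<close>

section \<open>Mixing entropy\<close>

text \<open>Since \<open>ln 0 = 0\<close>, this is the logarithm of \<open>self_powr\<close>, the value at \<open>0\<close> included.\<close>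

definition xlnx :: "real \<Rightarrow> real" where
  "xlnx x = x * ln x"

lemma self_powr_eq_exp_xlnx: "0 \<le> x \<Longrightarrow> self_powr x = exp (xlnx x)"
  by (auto simp: self_powr_def xlnx_def powr_def)

lemma xlnx_0 [simp]: "xlnx 0 = 0"
  by (simp add: xlnx_def)

lemma xlnx_mult: "0 < c \<Longrightarrow> 0 \<le> x \<Longrightarrow> xlnx (c * x) = c * xlnx x + x * xlnx c"
  by (cases "x = 0") (auto simp: xlnx_def ln_mult algebra_simps)

lemma xlnx_add_ge:
  assumes "0 \<le> x" "0 \<le> y"
  shows "xlnx x + xlnx y \<le> xlnx (x + y)"
proof -
  have "x * ln x \<le> x * ln (x + y)"
    by (cases "x = 0") (use assms in \<open>auto intro!: mult_left_mono ln_mono\<close>)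
  moreover have "y * ln y \<le> y * ln (x + y)"
    by (cases "y = 0") (use assms in \<open>auto intro!: mult_left_mono ln_mono\<close>)
  ultimately show ?thesis
    by (simp add: xlnx_def algebra_simps)
qed

text \<open>For small \<open>s\<close> the increment \<open>xlnx (x + s) - xlnx x\<close> is of order \<open>s\<close> and \<open>- xlnx s\<close> is much
  larger. This is what pushes a maximizer away from the boundary.\<close>

lemma xlnx_add_ge_log:
  assumes "0 < x" "0 < s"
  shows "xlnx x + xlnx s + s * ln (x / s) \<le> xlnx (x + s)"
proof -
  have "x * ln x \<le> x * ln (x + s)" "s * ln x \<le> s * ln (x + s)"
    using assms by (auto intro!: mult_left_mono ln_mono)
  moreover have "xlnx x + xlnx s + s * ln (x / s) = x * ln x + s * ln x"
    using assms by (simp add: xlnx_def algebra_simps ln_div)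
  ultimately show ?thesis
    by (simp add: xlnx_def distrib_right)
qed

lemma continuous_on_xlnx: "continuous_on {0..} xlnx"
  unfolding continuous_on_def
proof
  fix x :: real assume "x \<in> {0..}"
  show "(xlnx \<longlongrightarrow> xlnx x) (at x within {0..})"
  proof (cases "x = 0")
    case True
    have "((\<lambda>x::real. x * ln x) \<longlongrightarrow> 0) (at_right 0)" by real_asymp
    then show ?thesis
      using True by (simp add: xlnx_def[abs_def] at_within_Ici_at_right)
  next
    case False
    then have "(xlnx \<longlongrightarrow> xlnx x) (at x)"
      unfolding xlnx_def[abs_def] by (intro tendsto_intros) auto
    then show ?thesis by (rule tendsto_within_subset) simp
  qed
qed

lemma tendsto_xlnx:
  assumes "(f \<longlonglongrightarrow> x)" "\<And>n. 0 \<le> f n" "0 \<le> x"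
  shows "(\<lambda>n. xlnx (f n)) \<longlonglongrightarrow> xlnx x"
  using continuous_on_tendsto_compose[OF continuous_on_xlnx assms(1)] assms(2,3) by auto

text \<open>One term of the Kullback--Leibler divergence, corrected by \<open>z - x\<close> so that it is nonnegative
  term by term. The correction cancels in sums over two families of equal mass.\<close>

definition rel_entropy :: "real \<Rightarrow> real \<Rightarrow> real" where
  "rel_entropy x z = x * ln x - x * ln z - x + z"

text \<open>With \<open>w = z / x\<close> this is \<open>ln w \<le> w - 1\<close>, where equality holds only for \<open>w = 1\<close>.\<close>

lemma rel_entropy_nonneg_strict:
  assumes "0 \<le> x" "0 \<le> z" "z = 0 \<Longrightarrow> x = 0"
  shows "0 \<le> rel_entropy x z \<and> (rel_entropy x z = 0 \<longrightarrow> x = z)"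
proof (cases "x = 0")
  case False
  then have pos: "0 < x" "0 < z" using assms by (auto simp: order_less_le)
  have eq: "rel_entropy x z = x * (z / x - 1 - ln (z / x))"
    using pos by (simp add: rel_entropy_def ln_div field_simps)
  have "0 \<le> z / x - 1 - ln (z / x)"
    using ln_le_minus_one[of "z / x"] pos by simp
  moreover have "z = x" if "z / x - 1 - ln (z / x) = 0"
    using ln_eq_minus_one[of "z / x"] pos that by simp
  ultimately show ?thesis
    using pos unfolding eq by (auto intro: mult_nonneg_nonneg simp del: diff_ge_0_iff_ge)
qed (use assms in \<open>auto simp: rel_entropy_def\<close>)

text \<open>The Shannon entropy of the normalized family \<open>x / sum x I\<close>, multiplied by its mass \<open>sum x I\<close>.
  It is the exponential growth rate of a multinomial coefficient.\<close>

definition mixing_entropy :: "'a set \<Rightarrow> ('a \<Rightarrow> real) \<Rightarrow> real" where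
  "mixing_entropy I x = xlnx (sum x I) - (\<Sum>i\<in>I. xlnx (x i))"

text \<open>Mixing increases entropy: the excess of the right-hand side is the divergence of \<open>x\<close> and of
  \<open>y\<close> from the multiples of \<open>x + y\<close> that have the same masses. It vanishes only if both are
  multiples of \<open>x + y\<close>, and then they are proportional. The proportionality is stated without quotients
  because a whole family may vanish, as in a row without non-blank cells.\<close>

lemma mixing_entropy_superadditive:
  assumes fin: "finite I" and nonneg: "\<And>i. i \<in> I \<Longrightarrow> 0 \<le> x i" "\<And>i. i \<in> I \<Longrightarrow> 0 \<le> y i"
  shows "mixing_entropy I x + mixing_entropy I y \<le> mixing_entropy I (\<lambda>i. x i + y i)"
    and "mixing_entropy I (\<lambda>i. x i + y i) = mixing_entropy I x + mixing_entropy I y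
      \<Longrightarrow> i \<in> I \<Longrightarrow> x i * sum y I = y i * sum x I"
proof -
  define X Y where "X = sum x I" and "Y = sum y I"
  define z where "z i = (x i + y i) / (X + Y)" for i
  have le: "x i \<le> X" "y i \<le> Y" if "i \<in> I" for i
    using that fin nonneg by (auto simp: X_def Y_def intro: member_le_sum)
  have XY: "0 \<le> X" "0 \<le> Y" using nonneg by (auto simp: X_def Y_def intro: sum_nonneg)
  \<comment> \<open>The computation of the divergence is the same for both families, so \<open>u\<close> stands for either.\<close>
  have summand: "rel_entropy (u i) (sum u I * z i) =
      xlnx (u i) - u i * (ln (sum u I) + ln (x i + y i) - ln (X + Y)) - u i + sum u I * z i"
    if i: "i \<in> I" and u: "u = x \<or> u = y" for i u
  proof (cases "u i = 0")
    case False
    then have "0 < sum u I" "0 < x i + y i" "0 < X + Y"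
      using le[OF i] nonneg[OF i] XY u by (auto simp: X_def Y_def)
    then show ?thesis
      by (simp add: rel_entropy_def xlnx_def z_def ln_mult ln_div)
  qed (simp add: rel_entropy_def)
  have gap_part: "(\<Sum>i\<in>I. rel_entropy (u i) (sum u I * z i)) =
      (\<Sum>i\<in>I. xlnx (u i)) - xlnx (sum u I) - (\<Sum>i\<in>I. u i * ln (x i + y i)) + sum u I * ln (X + Y)"
    if u: "u = x \<or> u = y" for u
  proof -
    have "sum u I * (\<Sum>i\<in>I. z i) = sum u I"
    proof (cases "X + Y = 0")
      case True
      then have "X = 0" "Y = 0" using XY by auto
      then show ?thesis using u by (auto simp: X_def Y_def)
    next
      case False
      have "(\<Sum>i\<in>I. z i) = (X + Y) / (X + Y)"
        by (simp add: z_def X_def Y_def sum.distrib flip: sum_divide_distrib)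
      then show ?thesis using False by simp
    qed
    moreover have "(\<Sum>i\<in>I. rel_entropy (u i) (sum u I * z i)) =
      (\<Sum>i\<in>I. xlnx (u i) - u i * (ln (sum u I) + ln (x i + y i) - ln (X + Y)) - u i + sum u I * z i)"
      using u by (intro sum.cong refl summand)
    moreover have "\<dots> = (\<Sum>i\<in>I. xlnx (u i)) - sum u I * ln (sum u I)
        - (\<Sum>i\<in>I. u i * ln (x i + y i)) + sum u I * ln (X + Y)
        - sum u I + sum u I * (\<Sum>i\<in>I. z i)"
      by (simp add: sum.distrib sum_subtractf algebra_simps flip: sum_distrib_left sum_distrib_right)
    ultimately show ?thesis
      unfolding xlnx_def by linarith
  qed
  have gap: "mixing_entropy I (\<lambda>i. x i + y i) - mixing_entropy I x - mixing_entropy I y =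
      (\<Sum>i\<in>I. rel_entropy (x i) (X * z i)) + (\<Sum>i\<in>I. rel_entropy (y i) (Y * z i))"
    using gap_part[of x] gap_part[of y]
    by (simp add: mixing_entropy_def X_def Y_def sum.distrib xlnx_def algebra_simps)
  have rel: "0 \<le> rel_entropy (x i) (X * z i) \<and> (rel_entropy (x i) (X * z i) = 0 \<longrightarrow> x i = X * z i)"
    "0 \<le> rel_entropy (y i) (Y * z i) \<and> (rel_entropy (y i) (Y * z i) = 0 \<longrightarrow> y i = Y * z i)"
    if "i \<in> I" for i
    by (rule rel_entropy_nonneg_strict; use le[OF that] nonneg[OF that] XY in \<open>auto simp: z_def\<close>)+
  show "mixing_entropy I x + mixing_entropy I y \<le> mixing_entropy I (\<lambda>i. x i + y i)"
    using gap rel by (smt (verit) sum_nonneg)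
  assume eq: "mixing_entropy I (\<lambda>i. x i + y i) = mixing_entropy I x + mixing_entropy I y"
    and i: "i \<in> I"
  have "(\<Sum>i\<in>I. rel_entropy (x i) (X * z i)) = 0" "(\<Sum>i\<in>I. rel_entropy (y i) (Y * z i)) = 0"
    using gap rel eq by (smt (verit) sum_nonneg)+
  then have "x i = X * z i" "y i = Y * z i"
    using rel i fin by (auto simp: sum_nonneg_eq_0_iff)
  then show "x i * sum y I = y i * sum x I"
    by (metis X_def Y_def mult.assoc mult.commute)
qed

text \<open>The terms with \<open>xlnx c\<close> produced by \<open>xlnx_mult\<close> cancel because the mass of the family is the
  sum of its entries.\<close>

lemma mixing_entropy_scale:
  assumes "finite I" "0 < c" "\<And>i. i \<in> I \<Longrightarrow> 0 \<le> x i"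
  shows "mixing_entropy I (\<lambda>i. c * x i) = c * mixing_entropy I x"
proof -
  have "xlnx (\<Sum>i\<in>I. c * x i) = c * xlnx (sum x I) + sum x I * xlnx c"
    using assms by (simp add: xlnx_mult sum_nonneg flip: sum_distrib_left)
  moreover have "(\<Sum>i\<in>I. xlnx (c * x i)) = c * (\<Sum>i\<in>I. xlnx (x i)) + sum x I * xlnx c"
    using assms by (simp add: xlnx_mult sum.distrib sum_distrib_left sum_distrib_right)
  ultimately show ?thesis by (simp add: mixing_entropy_def algebra_simps)
qed

lemma mixing_entropy_fun_upd:
  assumes "finite I" "i \<in> I" "x i = 0"
  shows "mixing_entropy I (x(i := s)) =
    mixing_entropy I x + (xlnx (sum x I + s) - xlnx (sum x I) - xlnx s)"
proof -
  have "sum f I = f i + sum f (I - {i})" for f :: "_ \<Rightarrow> real"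
    using assms by (intro sum.remove)
  note this[of x] this[of "x(i := s)"] this[of "\<lambda>j. xlnx (x j)"] this[of "\<lambda>j. xlnx ((x(i := s)) j)"]
  moreover have "sum (x(i := s)) (I - {i}) = sum x (I - {i})"
    "(\<Sum>j\<in>I - {i}. xlnx ((x(i := s)) j)) = (\<Sum>j\<in>I - {i}. xlnx (x j))"
    by (auto intro: sum.cong)
  ultimately show ?thesis using assms by (simp add: mixing_entropy_def add_ac)
qed

lemma tendsto_mixing_entropy:
  assumes "\<And>i. i \<in> I \<Longrightarrow> (\<lambda>n. X n i) \<longlonglongrightarrow> x i" "\<And>n i. i \<in> I \<Longrightarrow> 0 \<le> X n i"
  shows "(\<lambda>n. mixing_entropy I (X n)) \<longlonglongrightarrow> mixing_entropy I x"
proof -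
  have "0 \<le> x i" if "i \<in> I" for i
    using assms that by (intro LIMSEQ_le_const[OF assms(1)]) auto
  then show ?thesis
    unfolding mixing_entropy_def using assms
    by (intro tendsto_diff tendsto_sum tendsto_xlnx) (auto intro: sum_nonneg)
qed

section \<open>The exponential growth rate of a cell distribution\<close>

text \<open>The logarithm of \<open>growth\<close>. Functions on the cells replace matrices, since they can be
  added, scaled and updated pointwise and also arise directly from cell counts.\<close>

definition log_growth :: "nat \<Rightarrow> nat \<Rightarrow> (nat \<times> nat \<Rightarrow> real) \<Rightarrow> real" where
  "log_growth u t x = (\<Sum>i<u. mixing_entropy {..<t} (\<lambda>j. x (i, j))) +
     (\<Sum>j<t. mixing_entropy {..<u} (\<lambda>i. x (i, j)))"

lemma log_growth_cong:
  "(\<And>p. p \<in> {..<u} \<times> {..<t} \<Longrightarrow> x p = y p) \<Longrightarrow> log_growth u t x = log_growth u t y"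
  unfolding log_growth_def mixing_entropy_def
  by (intro arg_cong2[where f = "(+)"] arg_cong2[where f = "(-)"] arg_cong[where f = xlnx] sum.cong) auto

lemma log_growth_scale:
  assumes "0 < c" "\<And>p. p \<in> {..<u} \<times> {..<t} \<Longrightarrow> 0 \<le> x p"
  shows "log_growth u t (\<lambda>p. c * x p) = c * log_growth u t x"
  unfolding log_growth_def distrib_left sum_distrib_left using assms
  by (intro arg_cong2[where f = "(+)"] sum.cong refl mixing_entropy_scale) auto

text \<open>Every line contributes a nonnegative excess by \<open>mixing_entropy_superadditive\<close>. If the total excess
  is zero, so is that of each line.\<close>

lemma log_growth_superadditive:
  assumes nonneg: "\<And>p. p \<in> {..<u} \<times> {..<t} \<Longrightarrow> 0 \<le> x p" "\<And>p. p \<in> {..<u} \<times> {..<t} \<Longrightarrow> 0 \<le> y p"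
  shows "log_growth u t x + log_growth u t y \<le> log_growth u t (\<lambda>p. x p + y p)"
    and "log_growth u t (\<lambda>p. x p + y p) = log_growth u t x + log_growth u t y \<Longrightarrow> i < u \<Longrightarrow> j < t \<Longrightarrow>
      x (i, j) * (\<Sum>k<t. y (i, k)) = y (i, j) * (\<Sum>k<t. x (i, k)) \<and>
      x (i, j) * (\<Sum>k<u. y (k, j)) = y (i, j) * (\<Sum>k<u. x (k, j))"
proof -
  define R where "R i = mixing_entropy {..<t} (\<lambda>j. x (i, j) + y (i, j)) -
    mixing_entropy {..<t} (\<lambda>j. x (i, j)) - mixing_entropy {..<t} (\<lambda>j. y (i, j))" for i
  define C where "C j = mixing_entropy {..<u} (\<lambda>i. x (i, j) + y (i, j)) -
    mixing_entropy {..<u} (\<lambda>i. x (i, j)) - mixing_entropy {..<u} (\<lambda>i. y (i, j))" for j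
  have gap: "log_growth u t (\<lambda>p. x p + y p) - log_growth u t x - log_growth u t y =
      (\<Sum>i<u. R i) + (\<Sum>j<t. C j)"
    by (simp add: log_growth_def R_def C_def sum_subtractf)
  have R: "0 \<le> R i" if "i < u" for i
    using mixing_entropy_superadditive(1)[of "{..<t}" "\<lambda>j. x (i, j)" "\<lambda>j. y (i, j)"] nonneg that
    by (simp add: R_def)
  have C: "0 \<le> C j" if "j < t" for j
    using mixing_entropy_superadditive(1)[of "{..<u}" "\<lambda>i. x (i, j)" "\<lambda>i. y (i, j)"] nonneg that
    by (simp add: C_def)
  have RC: "0 \<le> (\<Sum>i<u. R i)" "0 \<le> (\<Sum>j<t. C j)"
    using R C by (auto intro: sum_nonneg)
  show "log_growth u t x + log_growth u t y \<le> log_growth u t (\<lambda>p. x p + y p)"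
    using gap RC by linarith
  assume eq: "log_growth u t (\<lambda>p. x p + y p) = log_growth u t x + log_growth u t y" and ij: "i < u" "j < t"
  have "(\<Sum>i<u. R i) = 0" "(\<Sum>j<t. C j) = 0"
    using gap RC eq by linarith+
  then have "R i = 0" "C j = 0"
    using sum_nonneg_eq_0_iff[of "{..<u}" R] sum_nonneg_eq_0_iff[of "{..<t}" C] R C ij by auto
  then show "x (i, j) * (\<Sum>k<t. y (i, k)) = y (i, j) * (\<Sum>k<t. x (i, k)) \<and>
      x (i, j) * (\<Sum>k<u. y (k, j)) = y (i, j) * (\<Sum>k<u. x (k, j))"
    using mixing_entropy_superadditive(2)[of "{..<t}" "\<lambda>j. x (i, j)" "\<lambda>j. y (i, j)" j]
      mixing_entropy_superadditive(2)[of "{..<u}" "\<lambda>i. x (i, j)" "\<lambda>i. y (i, j)" i] nonneg ij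
    by (simp add: R_def C_def)
qed

lemma log_growth_fun_upd:
  assumes "a < u" "b < t" "x (a, b) = 0"
  shows "log_growth u t (x((a, b) := s)) = log_growth u t x +
    (xlnx ((\<Sum>j<t. x (a, j)) + s) - xlnx (\<Sum>j<t. x (a, j)) - xlnx s) +
    (xlnx ((\<Sum>i<u. x (i, b)) + s) - xlnx (\<Sum>i<u. x (i, b)) - xlnx s)"
    (is "_ = _ + ?R + ?C")
proof -
  have "mixing_entropy {..<t} (\<lambda>j. (x((a, b) := s)) (i, j)) =
      mixing_entropy {..<t} (\<lambda>j. x (i, j)) + (if i = a then ?R else 0)" for i
  proof (cases "i = a")
    case True
    have "(\<lambda>j. (x((a, b) := s)) (a, j)) = (\<lambda>j. x (a, j))(b := s)" by auto
    then show ?thesis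
      using True assms mixing_entropy_fun_upd[of "{..<t}" b "\<lambda>j. x (a, j)" s] by simp
  qed auto
  moreover have "mixing_entropy {..<u} (\<lambda>i. (x((a, b) := s)) (i, j)) =
      mixing_entropy {..<u} (\<lambda>i. x (i, j)) + (if j = b then ?C else 0)" for j
  proof (cases "j = b")
    case True
    have "(\<lambda>i. (x((a, b) := s)) (i, b)) = (\<lambda>i. x (i, b))(a := s)" by auto
    then show ?thesis
      using True assms mixing_entropy_fun_upd[of "{..<u}" a "\<lambda>i. x (i, b)" s] by simp
  qed auto
  ultimately show ?thesis
    using assms by (simp add: log_growth_def sum.distrib)
qed

lemma tendsto_log_growth:
  assumes "\<And>p. p \<in> {..<u} \<times> {..<t} \<Longrightarrow> (\<lambda>n. X n p) \<longlonglongrightarrow> x p"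
    and "\<And>n p. p \<in> {..<u} \<times> {..<t} \<Longrightarrow> 0 \<le> X n p"
  shows "(\<lambda>n. log_growth u t (X n)) \<longlonglongrightarrow> log_growth u t x"
  unfolding log_growth_def using assms
  by (intro tendsto_add tendsto_sum tendsto_mixing_entropy) auto

text \<open>Factors \<open>self_powr 0 = 1\<close> may be added to the denominators of \<open>growth\<close>, which then range over
  whole lines.\<close>

lemma growth_eq_exp_log_growth:
  assumes "\<Gamma> \<in> carrier_mat u t" "\<And>p. p \<in> {..<u} \<times> {..<t} \<Longrightarrow> 0 \<le> \<Gamma> $$ p"
  shows "growth \<Gamma> = exp (log_growth u t (($$) \<Gamma>))"
proof -
  have line: "self_powr (sum x I) / (\<Prod>i\<in>{i. i \<in> I \<and> x i \<noteq> 0}. self_powr (x i)) = exp (mixing_entropy I x)"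
    if "finite I" "\<And>i. i \<in> I \<Longrightarrow> 0 \<le> x i" for I :: "nat set" and x
  proof -
    have "(\<Prod>i\<in>{i. i \<in> I \<and> x i \<noteq> 0}. self_powr (x i)) = (\<Prod>i\<in>I. self_powr (x i))"
      using that by (intro prod.mono_neutral_left) (auto simp: self_powr_def)
    then show ?thesis
      using that by (simp add: self_powr_eq_exp_xlnx sum_nonneg mixing_entropy_def exp_diff exp_sum)
  qed
  have "dim_row \<Gamma> = u" "dim_col \<Gamma> = t" using assms by auto
  moreover have "self_powr (row_sum \<Gamma> i) / (\<Prod>j\<in>{j. j < t \<and> \<Gamma> $$ (i, j) \<noteq> 0}. self_powr (\<Gamma> $$ (i, j))) =
      exp (mixing_entropy {..<t} (\<lambda>j. \<Gamma> $$ (i, j)))" if "i < u" for i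
    using line[of "{..<t}" "\<lambda>j. \<Gamma> $$ (i, j)"] assms that by (simp add: row_sum_def)
  moreover have "self_powr (col_sum \<Gamma> j) / (\<Prod>i\<in>{i. i < u \<and> \<Gamma> $$ (i, j) \<noteq> 0}. self_powr (\<Gamma> $$ (i, j))) =
      exp (mixing_entropy {..<u} (\<lambda>i. \<Gamma> $$ (i, j)))" if "j < t" for j
    using line[of "{..<u}" "\<lambda>i. \<Gamma> $$ (i, j)"] assms that by (simp add: col_sum_def)
  ultimately show ?thesis
    by (simp add: growth_def log_growth_def exp_add exp_sum)
qed

section \<open>Distributions on the cells and the unique maximizer\<close>

text \<open>Connectedness enters the argument in this form: a property that spreads along rows and
  columns from one non-blank cell reaches all of them. Adjacent cells share a line, so it is enough to
  follow the paths of the cell graph.\<close>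

lemma connected_cells_induct:
  assumes conn: "connected_gridding_matrix M"
    and p: "p \<in> nonblank_cells M" "P p"
    and step: "\<And>p q. p \<in> nonblank_cells M \<Longrightarrow> q \<in> nonblank_cells M \<Longrightarrow> P p \<Longrightarrow>
      fst p = fst q \<or> snd p = snd q \<Longrightarrow> P q"
    and q: "q \<in> nonblank_cells M"
  shows "P q"
proof -
  let ?G = "mk_symmetric (with_proj (cell_graph M))"
  have verts: "verts (with_proj ?G) = nonblank_cells M"
    by (simp add: cell_graph_def)
  have "p \<rightarrow>\<^sup>*\<^bsub>with_proj ?G\<^esub> q"
    using conn p q verts
    unfolding connected_gridding_matrix_def Digraph_Component.connected_def strongly_connected_def by metis
  then have "(p, q) \<in> rtrancl_on (nonblank_cells M) (arcs_ends (with_proj ?G))"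
    unfolding reachable_def verts .
  then show ?thesis
  proof (induction rule: rtrancl_on_induct)
    case base
    show ?case by (rule p(2))
  next
    case (step a b)
    then have "(a, b) \<in> parcs ?G" by (simp add: arcs_ends_def arc_to_ends_def)
    then have "cell_adjacent M a b \<or> cell_adjacent M b a"
      by (auto simp: parcs_mk_symmetric cell_graph_def)
    then have "fst a = fst b \<or> snd a = snd b"
      by (auto simp: cell_adjacent_def)
    then show ?case using step assms(4) by blast
  qed
qed

definition distribution :: "gridding_matrix \<Rightarrow> (nat \<times> nat \<Rightarrow> real) \<Rightarrow> bool" where
  "distribution M x \<longleftrightarrow> (\<forall>p\<in>positions M. 0 \<le> x p \<and> (M $$ p = Blank \<longrightarrow> x p = 0)) \<and>
     (\<Sum>p\<in>positions M. x p) = 1"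

lemma finite_positions [simp]: "finite (positions M)"
  by (simp add: positions_def)

lemma distributionD:
  assumes "distribution M x" "p \<in> positions M"
  shows "0 \<le> x p" and "M $$ p = Blank \<Longrightarrow> x p = 0"
  using assms by (auto simp: distribution_def)

lemma nonblank_cells_subset: "nonblank_cells M \<subseteq> positions M"
  by (auto simp: nonblank_cells_def)

abbreviation matrix_log_growth :: "gridding_matrix \<Rightarrow> (nat \<times> nat \<Rightarrow> real) \<Rightarrow> real" where
  "matrix_log_growth M \<equiv> log_growth (dim_row M) (dim_col M)"

definition maximal_distribution :: "gridding_matrix \<Rightarrow> (nat \<times> nat \<Rightarrow> real) \<Rightarrow> bool" where
  "maximal_distribution M x \<longleftrightarrow> distribution M x \<and>
     (\<forall>y. distribution M y \<longrightarrow> matrix_log_growth M y \<le> matrix_log_growth M x)"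

lemma maximal_distribution_of_matrix:
  assumes "maximal_distribution_matrix M \<Gamma>"
  shows "maximal_distribution M (($$) \<Gamma>)"
proof -
  have growth: "growth \<Delta> = exp (matrix_log_growth M (($$) \<Delta>))" if "distribution_matrix M \<Delta>" for \<Delta>
    using that by (intro growth_eq_exp_log_growth) (auto simp: distribution_matrix_def positions_def)
  have \<Gamma>: "distribution_matrix M \<Gamma>"
    using assms by (simp add: maximal_distribution_matrix_def)
  have "matrix_log_growth M y \<le> matrix_log_growth M (($$) \<Gamma>)" if y: "distribution M y" for y
  proof -
    define \<Delta> where "\<Delta> = mat (dim_row M) (dim_col M) y"
    have eq: "\<Delta> $$ p = y p" if "p \<in> positions M" for p
      using that by (cases p) (simp add: \<Delta>_def positions_def)
    have \<Delta>: "distribution_matrix M \<Delta>"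
      using y by (auto simp: distribution_matrix_def distribution_def eq) (simp add: \<Delta>_def)
    then have "growth \<Delta> \<le> growth \<Gamma>"
      using assms by (simp add: maximal_distribution_matrix_def)
    moreover have "matrix_log_growth M (($$) \<Delta>) = matrix_log_growth M y"
      by (rule log_growth_cong) (simp add: eq positions_def)
    ultimately show ?thesis
      by (simp add: growth \<Gamma> \<Delta>)
  qed
  then show ?thesis
    using \<Gamma> by (auto simp: maximal_distribution_def distribution_matrix_def distribution_def)
qed

lemma distribution_scale:
  assumes "\<And>p. p \<in> positions M \<Longrightarrow> 0 \<le> x p \<and> (M $$ p = Blank \<longrightarrow> x p = 0)"
    and "(\<Sum>p\<in>positions M. x p) = c" "0 < c"
  shows "distribution M (\<lambda>p. (1 / c) * x p)"
  using assms by (auto simp: distribution_def simp flip: sum_divide_distrib)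

text \<open>Homogeneity extends maximality to weights of arbitrary mass, which spares the normalization of
  perturbed and added distributions.\<close>

lemma log_growth_le_mass_times_maximum:
  assumes max: "maximal_distribution M \<gamma>"
    and x: "\<And>p. p \<in> positions M \<Longrightarrow> 0 \<le> x p \<and> (M $$ p = Blank \<longrightarrow> x p = 0)"
    and c: "(\<Sum>p\<in>positions M. x p) = c" "0 < c"
  shows "matrix_log_growth M x \<le> c * matrix_log_growth M \<gamma>"
proof -
  have "matrix_log_growth M (\<lambda>p. (1 / c) * x p) \<le> matrix_log_growth M \<gamma>"
    using max distribution_scale[OF x c] by (simp add: maximal_distribution_def)
  moreover have "matrix_log_growth M (\<lambda>p. (1 / c) * x p) = (1 / c) * matrix_log_growth M x"
    using c x by (intro log_growth_scale) (auto simp: positions_def)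
  ultimately have "(1 / c) * matrix_log_growth M x \<le> matrix_log_growth M \<gamma>"
    by (simp only:)
  then show ?thesis
    using c by (simp add: field_simps)
qed

lemma entry_le_line_sums:
  fixes x :: "nat \<times> nat \<Rightarrow> real"
  assumes "\<And>p. p \<in> positions M \<Longrightarrow> 0 \<le> x p" "(i, j) \<in> positions M"
  shows "x (i, j) \<le> (\<Sum>k<dim_col M. x (i, k))" "x (i, j) \<le> (\<Sum>k<dim_row M. x (k, j))"
  using assms member_le_sum[of j "{..<dim_col M}" "\<lambda>k. x (i, k)"]
    member_le_sum[of i "{..<dim_row M}" "\<lambda>k. x (k, j)"]
  by (auto simp: positions_def)

text \<open>Suppose that a cell \<open>q\<close> has weight zero and shares a line with a cell of positive weight. Placing
  a small weight \<open>s\<close> on \<open>q\<close> raises the mass, and hence the allowed growth, by a multiple of \<open>s\<close> only,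
  while the entropy of that line grows by at least \<open>s * ln (w / s)\<close>, where \<open>w\<close> is the weight of the line.
  For small \<open>s\<close> this contradicts maximality. So positivity spreads along lines.\<close>

lemma maximal_distribution_pos:
  assumes conn: "connected_gridding_matrix M" and max: "maximal_distribution M x"
    and q: "q \<in> nonblank_cells M"
  shows "0 < x q"
proof -
  have x: "distribution M x" using max by (simp add: maximal_distribution_def)
  note nonneg = distributionD(1)[OF x]
  have "\<exists>p\<in>positions M. x p \<noteq> 0"
    using x by (auto simp: distribution_def intro: ccontr)
  then obtain p where p: "p \<in> positions M" "x p \<noteq> 0" by blast
  then have "p \<in> nonblank_cells M" "0 < x p"
    using x by (auto simp: distribution_def nonblank_cells_def order_less_le)
  then show ?thesis
  proof (rule connected_cells_induct[OF conn _ _ _ q, where P = "\<lambda>p. 0 < x p"])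
    fix p q assume p: "p \<in> nonblank_cells M" "0 < x p" and q: "q \<in> nonblank_cells M"
      and line: "fst p = fst q \<or> snd p = snd q"
    obtain a b where ab: "q = (a, b)" by (cases q)
    have ab_in: "a < dim_row M" "b < dim_col M" "(a, b) \<in> positions M"
      using q by (auto simp: ab nonblank_cells_def positions_def)
    define \<rho> \<kappa> where "\<rho> = (\<Sum>j<dim_col M. x (a, j))" and "\<kappa> = (\<Sum>i<dim_row M. x (i, b))"
    have nn: "0 \<le> \<rho>" "0 \<le> \<kappa>"
      using nonneg ab_in by (auto simp: \<rho>_def \<kappa>_def positions_def intro!: sum_nonneg)
    define w where "w = (if fst p = a then \<rho> else \<kappa>)"
    have "x p \<le> w"
      using entry_le_line_sums[of M x "fst p" "snd p"] nonneg p line nonblank_cells_subset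
      by (auto simp: w_def \<rho>_def \<kappa>_def ab)
    then have w: "0 < w" using p by simp
    show "0 < x q"
    proof (rule ccontr)
      assume "\<not> 0 < x q"
      then have zero: "x (a, b) = 0" using nonneg[OF ab_in(3)] by (simp add: ab)
      define G where "G = matrix_log_growth M x"
      \<comment> \<open>This \<open>s\<close> is so small that the gain \<open>s * ln (w / s)\<close> exceeds the allowance \<open>s * G\<close>.\<close>
      define s where "s = w * exp (- G - 1)"
      have s: "0 < s" using w by (simp add: s_def)
      have "ln (w / s) = G + 1" using w by (simp add: s_def ln_div ln_mult)
      have gain: "s * (G + 1) \<le> (xlnx (\<rho> + s) - xlnx \<rho> - xlnx s) + (xlnx (\<kappa> + s) - xlnx \<kappa> - xlnx s)"
        using xlnx_add_ge_log[OF w s] xlnx_add_ge[of \<rho> s] xlnx_add_ge[of \<kappa> s] nn s \<open>ln (w / s) = G + 1\<close>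
        by (cases "fst p = a") (simp_all add: w_def)
      have "matrix_log_growth M (x((a, b) := s)) \<le> (1 + s) * G"
        unfolding G_def
      proof (rule log_growth_le_mass_times_maximum[OF max])
        show "0 \<le> (x((a, b) := s)) p \<and> (M $$ p = Blank \<longrightarrow> (x((a, b) := s)) p = 0)"
          if "p \<in> positions M" for p
          using that q s distributionD[OF x that] by (auto simp: ab nonblank_cells_def)
        have "(\<Sum>p\<in>positions M. (x((a, b) := s)) p) =
            (\<Sum>p\<in>positions M. x p + (if p = (a, b) then s else 0))"
          by (intro sum.cong) (auto simp: zero)
        then show "(\<Sum>p\<in>positions M. (x((a, b) := s)) p) = 1 + s"
          using x ab_in by (simp add: sum.distrib distribution_def)
        show "0 < 1 + s" using s by simp
      qed
      moreover have "matrix_log_growth M (x((a, b) := s)) = G +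
          (xlnx (\<rho> + s) - xlnx \<rho> - xlnx s) + (xlnx (\<kappa> + s) - xlnx \<kappa> - xlnx s)"
        unfolding G_def \<rho>_def \<kappa>_def
          by (rule log_growth_fun_upd[of a "dim_row M" b "dim_col M" x s, OF ab_in(1,2) zero])
      ultimately have "G + s * (G + 1) \<le> (1 + s) * G" using gain by linarith
      then show False using s by (simp add: algebra_simps)
    qed
  qed
qed

text \<open>The sum of two maximizers has mass 2, so it cannot grow faster than at twice the maximal rate. This
  is equality in superadditivity, so the maximizers are proportional along every line. Because both are
  positive on the non-blank cells, their ratio is the same on any two cells that share a line, hence on
  all cells by connectedness, and it is 1 since both have mass 1.\<close>

lemma maximal_distribution_unique:
  assumes conn: "connected_gridding_matrix M"
    and max: "maximal_distribution M x" "maximal_distribution M y"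
    and p: "p \<in> positions M"
  shows "x p = y p"
proof -
  define G where "G = matrix_log_growth M x"
  have xy: "distribution M x" "distribution M y" using max by (simp_all add: maximal_distribution_def)
  have Gy: "matrix_log_growth M y = G"
    using max xy by (auto simp: maximal_distribution_def G_def intro: order_antisym)
  have le: "matrix_log_growth M (\<lambda>p. x p + y p) \<le> 2 * G"
    unfolding G_def using xy
    by (intro log_growth_le_mass_times_maximum[OF max(1)]) (auto simp: distribution_def sum.distrib)
  have nonneg: "\<And>p. p \<in> {..<dim_row M} \<times> {..<dim_col M} \<Longrightarrow> 0 \<le> x p"
    "\<And>p. p \<in> {..<dim_row M} \<times> {..<dim_col M} \<Longrightarrow> 0 \<le> y p"
    using distributionD(1)[OF xy(1)] distributionD(1)[OF xy(2)] by (simp_all add: positions_def)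
  have "matrix_log_growth M (\<lambda>p. x p + y p) = matrix_log_growth M x + matrix_log_growth M y"
    using log_growth_superadditive(1)[of "dim_row M" "dim_col M" x y, OF nonneg] le Gy by (simp add: G_def)
  then have proportional: "x (i, j) * (\<Sum>k<dim_col M. y (i, k)) = y (i, j) * (\<Sum>k<dim_col M. x (i, k))"
    "x (i, j) * (\<Sum>k<dim_row M. y (k, j)) = y (i, j) * (\<Sum>k<dim_row M. x (k, j))"
    if "i < dim_row M" "j < dim_col M" for i j
    using log_growth_superadditive(2)[of "dim_row M" "dim_col M" x y i j] nonneg that by blast+
  have pos: "0 < x q" "0 < y q" if "q \<in> nonblank_cells M" for q
    using maximal_distribution_pos[OF conn _ that] max by auto
  obtain p0 where p0: "p0 \<in> nonblank_cells M"
    using conn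
    by (auto simp: connected_gridding_matrix_def Digraph_Component.connected_def strongly_connected_def cell_graph_def)
  define c where "c = y p0 / x p0"
  have ratio: "y q / x q = c" if "q \<in> nonblank_cells M" for q
  proof (rule connected_cells_induct[OF conn p0 _ _ that, where P = "\<lambda>q. y q / x q = c"])
    show "y p0 / x p0 = c" by (simp add: c_def)
  next
    fix q r assume q: "q \<in> nonblank_cells M" "y q / x q = c" and r: "r \<in> nonblank_cells M"
      and line: "fst q = fst r \<or> snd q = snd r"
    have along_line: "y r / x r = c"
      if "x q * Y = y q * X" "x r * Y = y r * X" "x q \<le> X" for X Y
    proof -
      have "0 < X" using that pos[OF q(1)] by linarith
      then have "y q / x q = Y / X" "y r / x r = Y / X"
        using that pos[OF q(1)] pos[OF r] by (simp_all add: field_simps)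
      then show ?thesis using q(2) by simp
    qed
    obtain i j i' j' where ij: "q = (i, j)" "r = (i', j')" by (cases q, cases r)
    have in_M: "(i, j) \<in> positions M" "i < dim_row M" "j < dim_col M" "i' < dim_row M" "j' < dim_col M"
      using q r by (auto simp: ij nonblank_cells_def positions_def)
    note le = entry_le_line_sums[of M x i j, OF distributionD(1)[OF xy(1)] in_M(1), simplified]
    from line consider "i = i'" | "j = j'" by (auto simp: ij)
    then show "y r / x r = c"
    proof cases
      case 1
      then show ?thesis
        using along_line[of "\<Sum>k<dim_col M. y (i, k)" "\<Sum>k<dim_col M. x (i, k)"]
          proportional(1)[OF in_M(2,3)] proportional(1)[OF in_M(4,5)] le by (simp add: ij)
    next
      case 2
      then show ?thesis
        using along_line[of "\<Sum>k<dim_row M. y (k, j)" "\<Sum>k<dim_row M. x (k, j)"]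
          proportional(2)[OF in_M(2,3)] proportional(2)[OF in_M(4,5)] le by (simp add: ij)
    qed
  qed
  have scaled: "y q = c * x q" if "q \<in> positions M" for q
  proof (cases "q \<in> nonblank_cells M")
    case True
    then show ?thesis using ratio[OF True] pos[OF True] by (simp add: field_simps)
  next
    case False
    then show ?thesis
      using that distributionD(2)[OF xy(1) that] distributionD(2)[OF xy(2) that] by (simp add: nonblank_cells_def)
  qed
  have "(\<Sum>q\<in>positions M. y q) = c * (\<Sum>q\<in>positions M. x q)"
    by (simp add: scaled sum_distrib_left)
  then have "c = 1" using xy by (simp add: distribution_def)
  then show ?thesis using scaled[OF p] by simp
qed

section \<open>The entropy gap away from the maximizer\<close>

lemma pointwise_convergent_subsequence:
  fixes X :: "nat \<Rightarrow> 'a \<Rightarrow> real"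
  assumes "finite P" "\<And>p. p \<in> P \<Longrightarrow> bounded (range (\<lambda>n. X n p))"
  shows "\<exists>r l. strict_mono (r :: nat \<Rightarrow> nat) \<and> (\<forall>p\<in>P. (\<lambda>n. X (r n) p) \<longlonglongrightarrow> l p)"
  using assms
proof (induction P rule: finite_induct)
  case empty
  show ?case by (intro exI[of _ id]) (auto simp: strict_mono_def)
next
  case (insert q P)
  then obtain r l where r: "strict_mono (r :: nat \<Rightarrow> nat)" "\<And>p. p \<in> P \<Longrightarrow> (\<lambda>n. X (r n) p) \<longlonglongrightarrow> l p"
    by (metis insertCI)
  have "bounded (range (\<lambda>n. X (r n) q))"
    using insert.prems[of q] by (rule bounded_subset) auto
  then obtain m r' where r': "strict_mono (r' :: nat \<Rightarrow> nat)" "((\<lambda>n. X (r n) q) \<circ> r') \<longlonglongrightarrow> m"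
    using bounded_imp_convergent_subsequence by blast
  have "(\<lambda>n. X (r (r' n)) p) \<longlonglongrightarrow> (l(q := m)) p" if "p \<in> insert q P" for p
    using LIMSEQ_subseq_LIMSEQ[OF r(2) r'(1), of p] r'(2) that by (auto simp: o_def)
  moreover have "strict_mono (\<lambda>n. r (r' n))"
    using strict_mono_o[OF r(1) r'(1)] by (simp add: o_def)
  ultimately show ?case
    by (intro exI[of _ "\<lambda>n. r (r' n)"] exI[of _ "l(q := m)"]) auto
qed

text \<open>Otherwise some distributions deviating at \<open>p\<close> have growth rates tending to the maximum. A
  subsequence converges at every cell, and by continuity its limit is another maximizer.\<close>

lemma growth_gap_at_cell:
  assumes conn: "connected_gridding_matrix M" and max: "maximal_distribution M \<gamma>"
    and p: "p \<in> positions M" and \<epsilon>: "0 < \<epsilon>"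
  shows "\<exists>\<delta>>0. \<forall>x. distribution M x \<longrightarrow> \<bar>x p - \<gamma> p\<bar> > \<epsilon> \<longrightarrow>
    matrix_log_growth M x \<le> matrix_log_growth M \<gamma> - \<delta>"
proof (rule ccontr)
  define G where "G = matrix_log_growth M \<gamma>"
  assume "\<not> ?thesis"
  then have "\<exists>x. distribution M x \<and> \<bar>x p - \<gamma> p\<bar> > \<epsilon> \<and> matrix_log_growth M x > G - 1 / real (Suc n)" for n
    unfolding G_def by (metis not_le of_nat_0_less_iff zero_less_Suc zero_less_divide_1_iff)
  then obtain X where X: "\<And>n. distribution M (X n)" "\<And>n. \<bar>X n p - \<gamma> p\<bar> > \<epsilon>"
    "\<And>n. matrix_log_growth M (X n) > G - 1 / real (Suc n)" by metis
  have le1: "0 \<le> X n q" "X n q \<le> 1" if "q \<in> positions M" for n q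
    using distributionD(1)[OF X(1)] member_le_sum[of q "positions M" "X n"] that X(1)[of n]
    by (auto simp: distribution_def)
  then have "bounded (range (\<lambda>n. X n q))" if "q \<in> positions M" for q
    using le1[OF that] by (intro boundedI[of _ 1]) (auto simp del: split_paired_All)
  then obtain r l where r: "strict_mono (r :: nat \<Rightarrow> nat)"
    and lim: "\<And>q. q \<in> positions M \<Longrightarrow> (\<lambda>n. X (r n) q) \<longlonglongrightarrow> l q"
    using pointwise_convergent_subsequence[of "positions M" X] finite_positions by metis
  have l: "distribution M l"
    unfolding distribution_def
  proof (intro conjI ballI impI)
    fix q assume q: "q \<in> positions M"
    show "0 \<le> l q" using le1 q by (intro LIMSEQ_le_const[OF lim[OF q]]) auto
    assume "M $$ q = Blank"
    then have "(\<lambda>n. X (r n) q) = (\<lambda>_. 0)" using distributionD(2)[OF X(1) q] by auto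
    then show "l q = 0" using lim[OF q] by (simp add: LIMSEQ_const_iff)
  next
    have "(\<lambda>n. \<Sum>q\<in>positions M. X (r n) q) \<longlonglongrightarrow> (\<Sum>q\<in>positions M. l q)"
      using lim by (intro tendsto_sum)
    moreover have "(\<lambda>n. \<Sum>q\<in>positions M. X (r n) q) = (\<lambda>_. 1)"
      using X(1) by (simp add: distribution_def)
    ultimately show "(\<Sum>q\<in>positions M. l q) = 1" by (simp add: LIMSEQ_const_iff)
  qed
  have "(\<lambda>n. matrix_log_growth M (X (r n))) \<longlonglongrightarrow> matrix_log_growth M l"
    using lim le1 by (intro tendsto_log_growth) (auto simp: positions_def)
  moreover have "(\<lambda>n. G - 1 / real (Suc (r n))) \<longlonglongrightarrow> G - 0"
    using LIMSEQ_subseq_LIMSEQ[OF LIMSEQ_Suc[OF lim_1_over_n] r] by (intro tendsto_intros) (simp add: o_def)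
  ultimately have "G \<le> matrix_log_growth M l"
    using X(3) by (intro LIMSEQ_le[of "\<lambda>n. G - 1 / real (Suc (r n))" G]) (auto intro: less_imp_le)
  then have "maximal_distribution M l"
    using max l by (auto simp: maximal_distribution_def G_def intro: order_trans)
  then have "l p = \<gamma> p"
    using maximal_distribution_unique[OF conn _ max p] by simp
  moreover have "(\<lambda>n. \<bar>X (r n) p - \<gamma> p\<bar>) \<longlonglongrightarrow> \<bar>l p - \<gamma> p\<bar>"
    using lim[OF p] by (intro tendsto_intros)
  then have "\<epsilon> \<le> \<bar>l p - \<gamma> p\<bar>"
    using X(2) by (intro LIMSEQ_le_const) (auto intro: less_imp_le)
  ultimately show False using \<epsilon> by simp
qed

lemma growth_gap:
  assumes conn: "connected_gridding_matrix M" and max: "maximal_distribution M \<gamma>" and \<epsilon>: "0 < \<epsilon>"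
  obtains \<delta> where "0 < \<delta>"
    and "\<And>x p. distribution M x \<Longrightarrow> p \<in> positions M \<Longrightarrow> \<bar>x p - \<gamma> p\<bar> > \<epsilon> \<Longrightarrow>
      matrix_log_growth M x \<le> matrix_log_growth M \<gamma> - \<delta>"
proof -
  obtain d where d: "\<And>p. p \<in> positions M \<Longrightarrow> 0 < d p"
    "\<And>p x. p \<in> positions M \<Longrightarrow> distribution M x \<Longrightarrow> \<bar>x p - \<gamma> p\<bar> > \<epsilon> \<Longrightarrow>
      matrix_log_growth M x \<le> matrix_log_growth M \<gamma> - d p"
    using growth_gap_at_cell[OF conn max _ \<epsilon>] by metis
  \<comment> \<open>The extra element 1 makes \<open>Min\<close> meaningful without a case distinction on \<open>positions M\<close>.\<close>
  define \<delta> where "\<delta> = Min (insert 1 (d ` positions M))"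
  have "0 < \<delta>" using d(1) by (simp add: \<delta>_def)
  moreover have "\<delta> \<le> d p" if "p \<in> positions M" for p
    using that by (simp add: \<delta>_def)
  ultimately show ?thesis
    using d(2) by (intro that[of \<delta>]) fastforce+
qed

section \<open>Words with prescribed letter counts in each block\<close>

lemma card_eq_sum_card_fibres:
  assumes "finite S" "finite I" "f ` S \<subseteq> I"
  shows "card S = (\<Sum>i\<in>I. card {s \<in> S. f s = i})"
  using sum.group[OF assms, of "\<lambda>_. 1 :: nat"] by simp

text \<open>The function \<open>g\<close> divides the positions \<open>S\<close> into blocks labelled by \<open>B\<close>, and \<open>a (b, i)\<close> is the
  number of letters \<open>i\<close> required in block \<open>b\<close>. A column word of a gridded permutation has the indices as
  positions, the columns as blocks and the rows as letters; a row word has the values as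
  positions, the rows as blocks and the columns as letters.\<close>

definition block_words ::
  "'s set \<Rightarrow> ('s \<Rightarrow> 'b) \<Rightarrow> 'b set \<Rightarrow> 'i set \<Rightarrow> ('b \<times> 'i \<Rightarrow> nat) \<Rightarrow> ('s \<Rightarrow> 'i) set" where
  "block_words S g B I a =
     {f \<in> S \<rightarrow>\<^sub>E I. \<forall>b\<in>B. \<forall>i\<in>I. card {s \<in> S. g s = b \<and> f s = i} = a (b, i)}"

lemma finite_block_words: "finite S \<Longrightarrow> finite I \<Longrightarrow> finite (block_words S g B I a)"
  by (rule finite_subset[of _ "S \<rightarrow>\<^sub>E I"]) (auto simp: block_words_def intro: finite_PiE)

lemma fun_upd_mem_block_words_iff:
  assumes "finite S" "x \<notin> S" "g x \<in> B" "i \<in> I" "f \<in> S \<rightarrow>\<^sub>E I"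
  shows "f(x := i) \<in> block_words (insert x S) g B I a \<longleftrightarrow>
    0 < a (g x, i) \<and> f \<in> block_words S g B I (a((g x, i) := a (g x, i) - 1))"
proof -
  have "{s \<in> insert x S. g s = b \<and> (f(x := i)) s = i'} =
      (if (b, i') = (g x, i) then insert x {s \<in> S. g s = b \<and> f s = i'}
       else {s \<in> S. g s = b \<and> f s = i'})" for b i'
    using assms(2) by auto
  then have card: "card {s \<in> insert x S. g s = b \<and> (f(x := i)) s = i'} =
      (if (b, i') = (g x, i) then Suc (card {s \<in> S. g s = b \<and> f s = i'})
       else card {s \<in> S. g s = b \<and> f s = i'})" for b i'
    using assms(1,2) by auto
  have mem: "f(x := i) \<in> insert x S \<rightarrow>\<^sub>E I"
    unfolding PiE_insert_eq using assms(4,5) by (intro image_eqI[of _ _ "(i, f)"]) auto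
  show ?thesis
  proof
    assume "f(x := i) \<in> block_words (insert x S) g B I a"
    then have *: "card {s \<in> insert x S. g s = b \<and> (f(x := i)) s = i'} = a (b, i')"
      if "b \<in> B" "i' \<in> I" for b i'
      using that unfolding block_words_def by blast
    have "0 < a (g x, i)"
      using *[OF assms(3,4)] unfolding card by simp
    moreover have "card {s \<in> S. g s = b \<and> f s = i'} = (a((g x, i) := a (g x, i) - 1)) (b, i')"
      if "b \<in> B" "i' \<in> I" for b i'
      using *[OF that] unfolding card by (auto split: if_splits)
    ultimately show "0 < a (g x, i) \<and> f \<in> block_words S g B I (a((g x, i) := a (g x, i) - 1))"
      using assms(5) unfolding block_words_def by blast
  next
    assume asm: "0 < a (g x, i) \<and> f \<in> block_words S g B I (a((g x, i) := a (g x, i) - 1))"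
    then have *: "card {s \<in> S. g s = b \<and> f s = i'} = (a((g x, i) := a (g x, i) - 1)) (b, i')"
      if "b \<in> B" "i' \<in> I" for b i'
      using that unfolding block_words_def by blast
    have "card {s \<in> insert x S. g s = b \<and> (f(x := i)) s = i'} = a (b, i')"
      if "b \<in> B" "i' \<in> I" for b i'
      using *[OF that] asm unfolding card by auto
    then show "f(x := i) \<in> block_words (insert x S) g B I a"
      using mem unfolding block_words_def by blast
  qed
qed

text \<open>The product of the multinomial coefficients of the blocks, without division. In the induction on
  the positions, the letter \<open>i\<close> at a new position \<open>x\<close> lowers the count \<open>a (g x, i)\<close> by one, which takes the
  factor \<open>a (g x, i)\<close> out of the factorials. Summed over \<open>i\<close>, these factors give the new size of the
  block of \<open>x\<close>.\<close>

lemma card_block_words: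
  assumes "finite S" "finite B" "finite I" "g ` S \<subseteq> B"
    and "\<And>b. b \<in> B \<Longrightarrow> (\<Sum>i\<in>I. a (b, i)) = card {s \<in> S. g s = b}"
  shows "card (block_words S g B I a) * (\<Prod>p\<in>B \<times> I. fact (a p)) =
    (\<Prod>b\<in>B. fact (card {s \<in> S. g s = b}))"
  using assms(1,4,5)
proof (induction S arbitrary: a rule: finite_induct)
  case empty
  then have "a p = 0" if "p \<in> B \<times> I" for p
    using that assms(3) by auto
  then have "block_words {} g B I a = {\<lambda>_. undefined}"
    by (auto simp: block_words_def)
  moreover have "(\<Prod>p\<in>B \<times> I. fact (a p)) = (1 :: nat)"
    using \<open>\<And>p. p \<in> B \<times> I \<Longrightarrow> a p = 0\<close> by (intro prod.neutral) auto
  ultimately show ?case by simp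
next
  case (insert x S)
  let ?W = "\<lambda>i. block_words S g B I (a((g x, i) := a (g x, i) - 1))"
  let ?I = "{i \<in> I. 0 < a (g x, i)}"
  have gx: "g x \<in> B" and gS: "g ` S \<subseteq> B" using insert.prems by auto
  have words: "block_words (insert x S) g B I a = (\<lambda>(i, f). f(x := i)) ` Sigma ?I ?W"
  proof -
    have "block_words (insert x S) g B I a = (\<lambda>(i, f). f(x := i)) `
        {(i, f) \<in> I \<times> (S \<rightarrow>\<^sub>E I). f(x := i) \<in> block_words (insert x S) g B I a}"
      (is "?L = ?R")
    proof
      show "?L \<subseteq> ?R"
      proof
        fix h assume h: "h \<in> ?L"
        then have "h \<in> insert x S \<rightarrow>\<^sub>E I" by (auto simp: block_words_def)
        then obtain i f where "i \<in> I" "f \<in> S \<rightarrow>\<^sub>E I" "h = f(x := i)"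
          unfolding PiE_insert_eq by auto
        then show "h \<in> ?R" using h by auto
      qed
    qed auto
    also have "{(i, f) \<in> I \<times> (S \<rightarrow>\<^sub>E I). f(x := i) \<in> block_words (insert x S) g B I a} = Sigma ?I ?W"
    proof -
      have "?W i \<subseteq> S \<rightarrow>\<^sub>E I" for i by (auto simp: block_words_def)
      then show ?thesis
        using fun_upd_mem_block_words_iff[of S x g B _ I] insert.hyps gx by blast
    qed
    finally show ?thesis .
  qed
  have inj: "inj_on (\<lambda>(i, f). f(x := i)) (Sigma ?I ?W)"
    by (rule inj_on_subset[OF inj_combinator[OF insert.hyps(2), of "\<lambda>_. I"]])
      (auto simp: block_words_def)
  have "card (block_words (insert x S) g B I a) = (\<Sum>i\<in>?I. card (?W i))"
    unfolding words card_image[OF inj]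
    using assms(3) insert.hyps(1) by (intro card_SigmaI) (auto intro: finite_block_words)
  then have "card (block_words (insert x S) g B I a) * (\<Prod>p\<in>B \<times> I. fact (a p)) =
      (\<Sum>i\<in>?I. card (?W i) * (\<Prod>p\<in>B \<times> I. fact (a p)))"
    by (simp add: sum_distrib_right)
  also have "\<dots> = (\<Sum>i\<in>?I. a (g x, i) * (\<Prod>b\<in>B. fact (card {s \<in> S. g s = b})))"
  proof (rule sum.cong[OF refl])
    fix i assume i: "i \<in> ?I"
    define a' where "a' = a((g x, i) := a (g x, i) - 1)"
    have "(\<Sum>i\<in>I. a' (b, i)) = card {s \<in> S. g s = b}" if b: "b \<in> B" for b
    proof (cases "b = g x")
      case True
      have "{s \<in> insert x S. g s = b} = insert x {s \<in> S. g s = b}"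
        using True by auto
      then have "(\<Sum>i\<in>I. a (b, i)) = Suc (card {s \<in> S. g s = b})"
        using insert.prems(2)[OF b] insert.hyps by simp
      moreover have "(\<Sum>i\<in>I. a (b, i)) = a (b, i) + (\<Sum>i\<in>I - {i}. a (b, i))"
        "(\<Sum>i\<in>I. a' (b, i)) = a' (b, i) + (\<Sum>i\<in>I - {i}. a' (b, i))"
        using i assms(3) by (auto intro: sum.remove)
      moreover have "(\<Sum>i\<in>I - {i}. a' (b, i)) = (\<Sum>i\<in>I - {i}. a (b, i))"
        by (rule sum.cong) (auto simp: a'_def)
      ultimately show ?thesis
        using i True by (auto simp: a'_def)
    next
      case False
      then have "{s \<in> insert x S. g s = b} = {s \<in> S. g s = b}"
        by auto
      then show ?thesis
        using insert.prems(2)[OF b] False by (simp add: a'_def)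
    qed
    then have "card (?W i) * (\<Prod>p\<in>B \<times> I. fact (a' p)) = (\<Prod>b\<in>B. fact (card {s \<in> S. g s = b}))"
      unfolding a'_def by (intro insert.IH gS)
    moreover have "(\<Prod>p\<in>B \<times> I. fact (a p)) = a (g x, i) * (\<Prod>p\<in>B \<times> I. fact (a' p))"
    proof -
      have "(\<Prod>p\<in>B \<times> I. fact (u p)) = fact (u (g x, i)) * (\<Prod>p\<in>B \<times> I - {(g x, i)}. fact (u p) :: nat)"
        for u :: "_ \<Rightarrow> nat"
        using i gx assms(2,3) by (intro prod.remove) auto
      note this[of a] this[of a']
      moreover have "(\<Prod>p\<in>B \<times> I - {(g x, i)}. fact (a p)) = (\<Prod>p\<in>B \<times> I - {(g x, i)}. fact (a' p) :: nat)"
        by (rule prod.cong) (auto simp: a'_def)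
      moreover have "fact (a (g x, i)) = a (g x, i) * fact (a' (g x, i))"
        using i by (simp add: a'_def fact_reduce[of "a (g x, i)"])
      ultimately show ?thesis by simp
    qed
    ultimately show "card (?W i) * (\<Prod>p\<in>B \<times> I. fact (a p)) =
        a (g x, i) * (\<Prod>b\<in>B. fact (card {s \<in> S. g s = b}))"
      by simp
  qed
  also have "\<dots> = (\<Sum>i\<in>?I. a (g x, i)) * (\<Prod>b\<in>B. fact (card {s \<in> S. g s = b}))"
    by (simp add: sum_distrib_right)
  also have "(\<Sum>i\<in>?I. a (g x, i)) = (\<Sum>i\<in>I. a (g x, i))"
    using assms(3) by (intro sum.mono_neutral_left) auto
  also have "\<dots> = card {s \<in> insert x S. g s = g x}"
    by (rule insert.prems(2)[OF gx])
  also have "\<dots> * (\<Prod>b\<in>B. fact (card {s \<in> S. g s = b})) =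
      (\<Prod>b\<in>B. fact (card {s \<in> insert x S. g s = b}))"
  proof -
    have *: "{s \<in> insert x S. g s = b} =
        (if b = g x then insert x {s \<in> S. g s = b} else {s \<in> S. g s = b})" for b
      by auto
    have "(\<Prod>b\<in>B - {g x}. fact (card {s \<in> insert x S. g s = b})) =
        (\<Prod>b\<in>B - {g x}. fact (card {s \<in> S. g s = b}) :: nat)"
      unfolding * by (rule prod.cong) auto
    moreover have split: "(\<Prod>b\<in>B. fact (card {s \<in> T. g s = b})) = fact (card {s \<in> T. g s = g x}) *
        (\<Prod>b\<in>B - {g x}. fact (card {s \<in> T. g s = b}) :: nat)" for T
      using gx assms(2) by (intro prod.remove)
    moreover have "fact (card {s \<in> insert x S. g s = g x}) =
        card {s \<in> insert x S. g s = g x} * (fact (card {s \<in> S. g s = g x}) :: nat)"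
      unfolding * using insert.hyps by simp
    ultimately show ?thesis
      unfolding split[of S] split[of "insert x S"] by simp
  qed
  finally show ?case .
qed

section \<open>Monotone bijections between finite sets\<close>

lemma fits_cell_cong: "(\<And>k. k \<in> S \<Longrightarrow> \<sigma> k = \<tau> k) \<Longrightarrow> fits_cell t \<sigma> S = fits_cell t \<tau> S"
  by (cases t) (auto simp: monotone_on_def)

lemma fits_cell_subset: "fits_cell t \<sigma> S \<Longrightarrow> T \<subseteq> S \<Longrightarrow> fits_cell t \<sigma> T"
  by (cases t) (auto simp: monotone_on_def)

text \<open>The largest element of \<open>P\<close> has to go to the largest or smallest element of \<open>Q\<close>, and induction
  treats the rest. The same observation yields uniqueness below.\<close>

lemma ex_bij_betw_fits_cell:
  assumes "finite P" "finite Q" "card P = card Q" "t = Blank \<Longrightarrow> P = {}"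
  shows "\<exists>m. bij_betw m P Q \<and> fits_cell t m P"
  using assms
proof (induction P arbitrary: Q rule: finite_linorder_max_induct)
  case empty
  then show ?case by (cases t) (auto simp: monotone_on_def)
next
  case (insert b P)
  define v where "v = (if t = Increasing then Max Q else Min Q)"
  have b: "b \<notin> P" using insert.hyps by auto
  have "Q \<noteq> {}" using insert.prems insert.hyps b by auto
  then have v: "v \<in> Q" using insert.prems by (auto simp: v_def)
  have "card P = card (Q - {v})"
    using insert.prems insert.hyps b v by simp
  then obtain m where m: "bij_betw m P (Q - {v})" "fits_cell t m P"
    using insert.IH[of "Q - {v}"] insert.prems by auto
  have "bij_betw (m(b := v)) P (Q - {v})"
    using m(1) b by (subst bij_betw_cong[of P _ m]) auto
  then have "bij_betw (m(b := v)) (insert b P) (insert v (Q - {v}))"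
    using b notIn_Un_bij_betw[of b P "m(b := v)" "Q - {v}"] by simp
  moreover have "insert v (Q - {v}) = Q" using v by auto
  moreover have mQ: "m k \<in> Q - {v}" if "k \<in> P" for k
    using m(1) that by (auto simp: bij_betw_def)
  have "fits_cell t (m(b := v)) (insert b P)"
  proof (cases t)
    case Increasing
    then have "m k < v" if "k \<in> P" for k
      using mQ[OF that] insert.prems(1) by (auto simp: v_def order_less_le)
    then show ?thesis
      using Increasing m(2) insert.hyps(2) by (fastforce simp: monotone_on_def)
  next
    case Decreasing
    then have "v < m k" if "k \<in> P" for k
      using mQ[OF that] insert.prems(1) by (auto simp: v_def order_less_le)
    then show ?thesis
      using Decreasing m(2) insert.hyps(2) by (fastforce simp: monotone_on_def)
  next
    case Blank
    then show ?thesis using insert.prems by simp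
  qed
  ultimately show ?case by auto
qed

lemma fits_cell_unique:
  assumes "finite P" "fits_cell t \<sigma> P" "fits_cell t \<tau> P" "\<sigma> ` P = \<tau> ` P" "k \<in> P"
  shows "\<sigma> k = \<tau> k"
  using assms
proof (induction P arbitrary: k rule: finite_linorder_max_induct)
  case (insert b P)
  have b: "b \<notin> P" using insert.hyps by auto
  have last: "\<sigma> b = \<tau> b"
  proof (cases t)
    case Increasing
    have "f b = Max (f ` insert b P)" if "fits_cell t f (insert b P)" for f :: "nat \<Rightarrow> nat"
      using that Increasing insert.hyps
      by (intro Max_eqI[symmetric]) (auto simp: monotone_on_def order_less_le)
    then show ?thesis using insert.prems by metis
  next
    case Decreasing
    have "f b = Min (f ` insert b P)" if "fits_cell t f (insert b P)" for f :: "nat \<Rightarrow> nat"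
      using that Decreasing insert.hyps
      by (intro Min_eqI[symmetric]) (auto simp: monotone_on_def order_less_le)
    then show ?thesis using insert.prems by metis
  next
    case Blank
    then show ?thesis using insert.prems by simp
  qed
  have "f ` P = f ` insert b P - {f b}" if "fits_cell t f (insert b P)" for f
    using that insert.hyps by (cases t) (auto simp: monotone_on_def)
  then have "\<sigma> ` P = \<tau> ` P"
    using insert.prems last by metis
  then show ?case
    using insert.IH[of k] insert.prems last fits_cell_subset by blast
qed auto

section \<open>Dividers\<close>

text \<open>The number of the column (or row) that contains a given index (or value).\<close>

definition slot :: "nat list \<Rightarrow> nat \<Rightarrow> nat" where
  "slot d k = (LEAST j. k \<le> d ! Suc j)"

lemma slot_eq_iff:
  assumes d: "dividers m n d" and k: "k \<in> {1..n}"
  shows "slot d k < m" and "j < m \<Longrightarrow> slot d k = j \<longleftrightarrow> k \<in> {d ! j<..d ! Suc j}"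
proof -
  have "m \<noteq> 0" using d k by (auto simp: dividers_def intro: ccontr)
  then obtain m' where m': "m = Suc m'" by (cases m) auto
  have last: "k \<le> d ! Suc m'" using d k m' by (auto simp: dividers_def)
  then have le: "k \<le> d ! Suc (slot d k)"
    unfolding slot_def by (rule LeastI)
  have "slot d k \<le> m'"
    unfolding slot_def using last by (rule Least_le)
  then show less: "slot d k < m" using m' by simp
  have gt: "d ! slot d k < k"
  proof (cases "slot d k")
    case 0
    then show ?thesis using d k by (auto simp: dividers_def)
  next
    case (Suc j)
    then have "\<not> k \<le> d ! Suc j"
      unfolding slot_def by (metis lessI not_less_Least)
    then show ?thesis using Suc by simp
  qed
  assume j: "j < m"
  have mono: "d ! a \<le> d ! b" if "a \<le> b" "b \<le> m" for a b
    using d that by (auto simp: dividers_def sorted_iff_nth_mono)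
  show "slot d k = j \<longleftrightarrow> k \<in> {d ! j<..d ! Suc j}"
  proof
    assume "k \<in> {d ! j<..d ! Suc j}"
    then have k': "d ! j < k" "k \<le> d ! Suc j" by auto
    show "slot d k = j"
    proof (rule linorder_cases)
      assume "slot d k < j"
      then have "d ! Suc (slot d k) \<le> d ! j" using mono j by auto
      then show ?thesis using le k' by auto
    next
      assume "j < slot d k"
      then have "d ! Suc j \<le> d ! slot d k" using mono less by auto
      then show ?thesis using gt k' by auto
    qed
  qed (use le gt in auto)
qed

lemma dividers_nth_le: "dividers m n d \<Longrightarrow> j \<le> m \<Longrightarrow> d ! j \<le> n"
  by (auto simp: dividers_def sorted_iff_nth_mono)

lemma slot_fibre:
  assumes "dividers m n d" "j < m"
  shows "{k \<in> {1..n}. slot d k = j} = {d ! j<..d ! Suc j}"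
proof -
  have "d ! Suc j \<le> n" using assms dividers_nth_le by auto
  then show ?thesis using slot_eq_iff(2)[OF assms(1) _ assms(2)] by fastforce
qed

definition dividers_of :: "nat \<Rightarrow> (nat \<Rightarrow> nat) \<Rightarrow> nat list" where
  "dividers_of m w = map (\<lambda>j. \<Sum>i<j. w i) [0..<Suc m]"

lemma dividers_of_nth: "j \<le> m \<Longrightarrow> dividers_of m w ! j = (\<Sum>i<j. w i)"
  unfolding dividers_of_def by (subst nth_map) (auto simp del: upt_Suc)

lemma dividers_dividers_of:
  assumes "(\<Sum>i<m. w i) = n"
  shows "dividers m n (dividers_of m w)"
proof -
  have len: "length (dividers_of m w) = Suc m" by (simp add: dividers_of_def)
  have "sorted (dividers_of m w)"
    unfolding sorted_iff_nth_mono len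
    by (auto simp: dividers_of_nth intro!: sum_mono2)
  then show ?thesis using assms len by (simp add: dividers_def dividers_of_nth)
qed

lemma dividers_eq_dividers_of:
  assumes d: "dividers m n d" and w: "\<And>j. j < m \<Longrightarrow> d ! Suc j - d ! j = w j"
  shows "d = dividers_of m w"
proof (rule nth_equalityI)
  show "length d = length (dividers_of m w)"
    using d by (simp add: dividers_def dividers_of_def)
  have "d ! j = (\<Sum>i<j. w i)" if "j \<le> m" for j
    using that
  proof (induction j)
    case (Suc j)
    moreover have "d ! j \<le> d ! Suc j"
      using Suc.prems d by (auto simp: dividers_def sorted_iff_nth_mono)
    ultimately show ?case using w[of j] by simp
  qed (use d in \<open>simp add: dividers_def\<close>)
  then show "d ! j = dividers_of m w ! j" if "j < length d" for j
    using that d by (simp add: dividers_of_nth dividers_def)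
qed

section \<open>Gridded permutations with prescribed cell counts\<close>

text \<open>From here on cells are described by slots (\<open>cell_points_eq_slots\<close>), which treats indices and values
  alike, and not by comparisons with dividers.\<close>

declare cell_points.simps [simp del]

lemma cell_points_eq_slots:
  assumes "\<sigma> permutes {1..n}" "dividers t n c" "dividers u n r" "i < u" "j < t"
  shows "cell_points (\<sigma>, c, r) (i, j) = {k \<in> {1..n}. slot c k = j \<and> slot r (\<sigma> k) = i}"
proof -
  have "k \<in> {1..n} \<and> slot c k = j \<longleftrightarrow> k \<in> {c ! j<..c ! Suc j}" for k
    using slot_fibre[OF assms(2,5)] by blast
  moreover have "slot r (\<sigma> k) = i \<longleftrightarrow> \<sigma> k \<in> {r ! i<..r ! Suc i}" if "k \<in> {1..n}" for k
    using slot_eq_iff(2)[OF assms(3) _ assms(4)] permutes_in_image[OF assms(1)] that by blast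
  ultimately show ?thesis by (auto simp: cell_points.simps)
qed

lemma gridded_cell_points:
  assumes "(\<sigma>, c, r) \<in> gridded_permutations M n" "i < dim_row M" "j < dim_col M"
  shows "cell_points (\<sigma>, c, r) (i, j) = {k \<in> {1..n}. slot c k = j \<and> slot r (\<sigma> k) = i}"
  using assms by (intro cell_points_eq_slots) (auto simp: gridded_permutations_def)

text \<open>All indices and all values from 1 to \<open>n\<close> occur, so the width of a column and the height of a row are
  the numbers of points in them.\<close>

lemma gridded_counts:
  assumes s: "(\<sigma>, c, r) \<in> gridded_permutations M n"
  shows "j < dim_col M \<Longrightarrow> c ! Suc j - c ! j = (\<Sum>i<dim_row M. card (cell_points (\<sigma>, c, r) (i, j)))"
    and "i < dim_row M \<Longrightarrow> r ! Suc i - r ! i = (\<Sum>j<dim_col M. card (cell_points (\<sigma>, c, r) (i, j)))"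
    and "(\<Sum>p\<in>positions M. card (cell_points (\<sigma>, c, r) p)) = n"
proof -
  have \<sigma>: "\<sigma> permutes {1..n}" and c: "dividers (dim_col M) n c" and r: "dividers (dim_row M) n r"
    using s by (auto simp: gridded_permutations_def)
  have \<sigma>_in: "\<sigma> k \<in> {1..n}" if "k \<in> {1..n}" for k
    using permutes_in_image[OF \<sigma>] that by blast
  have col: "c ! Suc j - c ! j = (\<Sum>i<dim_row M. card (cell_points (\<sigma>, c, r) (i, j)))"
    if j: "j < dim_col M" for j
  proof -
    have "card {k \<in> {1..n}. slot c k = j} =
        (\<Sum>i<dim_row M. card {k \<in> {k \<in> {1..n}. slot c k = j}. slot r (\<sigma> k) = i})"
      using slot_eq_iff(1)[OF r \<sigma>_in] by (intro card_eq_sum_card_fibres) auto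
    also have "\<dots> = (\<Sum>i<dim_row M. card (cell_points (\<sigma>, c, r) (i, j)))"
      using j by (intro sum.cong refl arg_cong[where f = card]) (auto simp: gridded_cell_points[OF s])
    finally show ?thesis unfolding slot_fibre[OF c j] by simp
  qed
  then show "j < dim_col M \<Longrightarrow> c ! Suc j - c ! j = (\<Sum>i<dim_row M. card (cell_points (\<sigma>, c, r) (i, j)))" .
  show "r ! Suc i - r ! i = (\<Sum>j<dim_col M. card (cell_points (\<sigma>, c, r) (i, j)))"
    if i: "i < dim_row M"
  proof -
    have "{v \<in> {1..n}. slot r v = i} = \<sigma> ` {k \<in> {1..n}. slot r (\<sigma> k) = i}"
    proof -
      have "{v \<in> {1..n}. slot r v = i} = {v \<in> \<sigma> ` {1..n}. slot r v = i}"
        by (simp only: permutes_image[OF \<sigma>])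
      also have "\<dots> = \<sigma> ` {k \<in> {1..n}. slot r (\<sigma> k) = i}"
        by (simp only: Compr_image_eq)
      finally show ?thesis .
    qed
    then have "card {v \<in> {1..n}. slot r v = i} = card {k \<in> {1..n}. slot r (\<sigma> k) = i}"
      by (simp add: card_image permutes_inj_on[OF \<sigma>])
    also have "\<dots> =
        (\<Sum>j<dim_col M. card {k \<in> {k \<in> {1..n}. slot r (\<sigma> k) = i}. slot c k = j})"
      using slot_eq_iff(1)[OF c] by (intro card_eq_sum_card_fibres) auto
    also have "\<dots> = (\<Sum>j<dim_col M. card (cell_points (\<sigma>, c, r) (i, j)))"
      using i by (intro sum.cong refl arg_cong[where f = card]) (auto simp: gridded_cell_points[OF s])
    finally show ?thesis unfolding slot_fibre[OF r i] by simp
  qed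
  have "(\<Sum>p\<in>positions M. card (cell_points (\<sigma>, c, r) p)) =
      (\<Sum>i<dim_row M. \<Sum>j<dim_col M. card (cell_points (\<sigma>, c, r) (i, j)))"
    by (simp add: positions_def sum.cartesian_product)
  also have "\<dots> = (\<Sum>j<dim_col M. \<Sum>i<dim_row M. card (cell_points (\<sigma>, c, r) (i, j)))"
    by (rule sum.swap)
  also have "\<dots> = (\<Sum>j<dim_col M. c ! Suc j - c ! j)"
    using col by simp
  also have "\<dots> = dividers_of (dim_col M) (\<lambda>j. c ! Suc j - c ! j) ! dim_col M"
    by (simp add: dividers_of_nth)
  also have "\<dots> = n"
    using dividers_eq_dividers_of[OF c refl] c by (simp add: dividers_def)
  finally show "(\<Sum>p\<in>positions M. card (cell_points (\<sigma>, c, r) p)) = n" .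
qed

definition gridded_with_counts ::
  "gridding_matrix \<Rightarrow> nat \<Rightarrow> (nat \<times> nat \<Rightarrow> nat) \<Rightarrow> gridded_permutation set" where
  "gridded_with_counts M n A =
     {s \<in> gridded_permutations M n. \<forall>p\<in>positions M. card (cell_points s p) = A p}"

text \<open>The dividers \<open>c\<close> and \<open>r\<close> are determined by \<open>A\<close>. A gridded permutation is mapped by \<open>\<Phi>\<close> to its column word
  (the row of the point at each index) and its row word (the column of the point at each value). The
  words determine the set of indices and the set of values of the points in each cell, and since the
  cell is monotone, the points themselves. Conversely, any two words of these kinds assign sets of the
  same size \<open>A p\<close> to the cell \<open>p\<close>, and joining them by monotone bijections gives a permutation. As all
  \<open>fact (A p)\<close> occur once for the rows and once for the columns, their product is squared.\<close>

lemma card_gridded_with_counts: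
  assumes total: "(\<Sum>p\<in>positions M. A p) = n"
    and blank: "\<And>p. p \<in> positions M \<Longrightarrow> M $$ p = Blank \<Longrightarrow> A p = 0"
  shows "card (gridded_with_counts M n A) * (\<Prod>p\<in>positions M. fact (A p))\<^sup>2 =
    (\<Prod>i<dim_row M. fact (\<Sum>j<dim_col M. A (i, j))) *
    (\<Prod>j<dim_col M. fact (\<Sum>i<dim_row M. A (i, j)))"
proof -
  define t u where "t = dim_col M" and "u = dim_row M"
  define c where "c = dividers_of t (\<lambda>j. \<Sum>i<u. A (i, j))"
  define r where "r = dividers_of u (\<lambda>i. \<Sum>j<t. A (i, j))"
  have pos: "positions M = {..<u} \<times> {..<t}" by (simp add: positions_def t_def u_def)
  have row_total: "(\<Sum>i<u. \<Sum>j<t. A (i, j)) = n"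
    using total by (simp add: pos sum.cartesian_product)
  have col_total: "(\<Sum>j<t. \<Sum>i<u. A (i, j)) = n"
    using row_total by (subst sum.swap)
  have c: "dividers t n c" and r: "dividers u n r"
    unfolding c_def r_def by (intro dividers_dividers_of row_total col_total)+
  have col_size: "card {k \<in> {1..n}. slot c k = j} = (\<Sum>i<u. A (i, j))" if "j < t" for j
    unfolding slot_fibre[OF c that] using that by (simp add: c_def dividers_of_nth)
  have row_size: "card {k \<in> {1..n}. slot r k = i} = (\<Sum>j<t. A (i, j))" if "i < u" for i
    unfolding slot_fibre[OF r that] using that by (simp add: r_def dividers_of_nth)
  \<comment> \<open>The column words \<open>F\<close> and the row words \<open>H\<close>. Cells are indexed row first, so the counts for
    the column words have to be transposed.\<close>
  define F where "F = block_words {1..n} (slot c) {..<t} {..<u} (\<lambda>(j, i). A (i, j))"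
  define H where "H = block_words {1..n} (slot r) {..<u} {..<t} A"
  have cardF: "card F * (\<Prod>p\<in>positions M. fact (A p)) = (\<Prod>j<t. fact (\<Sum>i<u. A (i, j)))"
  proof -
    have "card F * (\<Prod>p\<in>{..<t} \<times> {..<u}. fact ((\<lambda>(j, i). A (i, j)) p)) =
        (\<Prod>j<t. fact (card {k \<in> {1..n}. slot c k = j}))"
      unfolding F_def using slot_eq_iff(1)[OF c] col_size
      by (intro card_block_words) auto
    moreover have "(\<Prod>p\<in>{..<t} \<times> {..<u}. fact ((\<lambda>(j, i). A (i, j)) p)) =
        (\<Prod>p\<in>positions M. fact (A p) :: nat)"
      unfolding pos by (rule prod.reindex_bij_witness[of _ prod.swap prod.swap]) auto
    ultimately show ?thesis using col_size by simp
  qed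
  have cardH: "card H * (\<Prod>p\<in>positions M. fact (A p)) = (\<Prod>i<u. fact (\<Sum>j<t. A (i, j)))"
  proof -
    have "card H * (\<Prod>p\<in>{..<u} \<times> {..<t}. fact (A p)) =
        (\<Prod>i<u. fact (card {k \<in> {1..n}. slot r k = i}))"
      unfolding H_def using slot_eq_iff(1)[OF r] row_size
      by (intro card_block_words) auto
    then show ?thesis using row_size by (simp add: pos)
  qed
  have F_iff: "f \<in> F \<longleftrightarrow> f \<in> {1..n} \<rightarrow>\<^sub>E {..<u} \<and>
      (\<forall>j<t. \<forall>i<u. card {k \<in> {1..n}. slot c k = j \<and> f k = i} = A (i, j))" for f
    by (auto simp: F_def block_words_def)
  have H_iff: "h \<in> H \<longleftrightarrow> h \<in> {1..n} \<rightarrow>\<^sub>E {..<t} \<and>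
      (\<forall>i<u. \<forall>j<t. card {v \<in> {1..n}. slot r v = i \<and> h v = j} = A (i, j))" for h
    by (auto simp: H_def block_words_def)
  define \<Phi> :: "gridded_permutation \<Rightarrow> _" where
    "\<Phi> = (\<lambda>(\<sigma>, _, _). (restrict (\<lambda>k. slot r (\<sigma> k)) {1..n}, restrict (\<lambda>v. slot c (inv_into UNIV \<sigma> v)) {1..n}))"
  have gridded: "c' = c \<and> r' = r \<and> \<sigma> permutes {1..n} \<and>
      (\<forall>i<u. \<forall>j<t. fits_cell (M $$ (i, j)) \<sigma> {k \<in> {1..n}. slot c k = j \<and> slot r (\<sigma> k) = i} \<and>
         card {k \<in> {1..n}. slot c k = j \<and> slot r (\<sigma> k) = i} = A (i, j))"
    if s: "(\<sigma>, c', r') \<in> gridded_with_counts M n A" for \<sigma> c' r'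
  proof -
    have mem: "(\<sigma>, c', r') \<in> gridded_permutations M n"
      and counts: "\<And>p. p \<in> positions M \<Longrightarrow> card (cell_points (\<sigma>, c', r') p) = A p"
      using s by (auto simp: gridded_with_counts_def)
    have perm: "\<sigma> permutes {1..n}" "dividers t n c'" "dividers u n r'"
      using mem by (auto simp: gridded_permutations_def t_def u_def)
    have "c' ! Suc j - c' ! j = (\<Sum>i<u. A (i, j))" if "j < t" for j
    proof -
      have "c' ! Suc j - c' ! j = (\<Sum>i<u. card (cell_points (\<sigma>, c', r') (i, j)))"
        using gridded_counts(1)[OF mem] that by (simp add: t_def u_def)
      also have "\<dots> = (\<Sum>i<u. A (i, j))"
        using that counts by (intro sum.cong) (auto simp: pos)
      finally show ?thesis .
    qed
    then have c': "c' = c"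
      unfolding c_def by (intro dividers_eq_dividers_of[OF perm(2)])
    have "r' ! Suc i - r' ! i = (\<Sum>j<t. A (i, j))" if "i < u" for i
    proof -
      have "r' ! Suc i - r' ! i = (\<Sum>j<t. card (cell_points (\<sigma>, c', r') (i, j)))"
        using gridded_counts(2)[OF mem] that by (simp add: t_def u_def)
      also have "\<dots> = (\<Sum>j<t. A (i, j))"
        using that counts by (intro sum.cong) (auto simp: pos)
      finally show ?thesis .
    qed
    then have r': "r' = r"
      unfolding r_def by (intro dividers_eq_dividers_of[OF perm(3)])
    have "fits_cell (M $$ (i, j)) \<sigma> {k \<in> {1..n}. slot c k = j \<and> slot r (\<sigma> k) = i} \<and>
         card {k \<in> {1..n}. slot c k = j \<and> slot r (\<sigma> k) = i} = A (i, j)" if "i < u" "j < t" for i j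
    proof -
      have "(i, j) \<in> positions M" using that by (simp add: pos)
      moreover have "cell_points (\<sigma>, c, r) (i, j) = {k \<in> {1..n}. slot c k = j \<and> slot r (\<sigma> k) = i}"
        using cell_points_eq_slots[OF perm(1) c r that] .
      ultimately show ?thesis
        using mem counts[of "(i, j)"] unfolding c' r' by (auto simp: gridded_permutations_def)
    qed
    then show ?thesis using c' r' perm(1) by blast
  qed
  \<comment> \<open>The indices of the points in a cell are read off the column word (left), their values
    off the row word (right).\<close>
  have image_fibre: "\<sigma> ` {k \<in> {1..n}. slot c k = j \<and> slot r (\<sigma> k) = i} =
      {v \<in> {1..n}. slot r v = i \<and> slot c (inv_into UNIV \<sigma> v) = j}" if \<sigma>: "\<sigma> permutes {1..n}" for \<sigma> i j
  proof (intro equalityI subsetI)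
    fix v assume "v \<in> \<sigma> ` {k \<in> {1..n}. slot c k = j \<and> slot r (\<sigma> k) = i}"
    then show "v \<in> {v \<in> {1..n}. slot r v = i \<and> slot c (inv_into UNIV \<sigma> v) = j}"
      using permutes_in_image[OF \<sigma>] permutes_inverses(2)[OF \<sigma>] by auto
  next
    fix v assume v: "v \<in> {v \<in> {1..n}. slot r v = i \<and> slot c (inv_into UNIV \<sigma> v) = j}"
    then have "inv_into UNIV \<sigma> v \<in> {k \<in> {1..n}. slot c k = j \<and> slot r (\<sigma> k) = i}"
      using permutes_in_image[OF permutes_inv[OF \<sigma>]] permutes_inverses(1)[OF \<sigma>] by auto
    then show "v \<in> \<sigma> ` {k \<in> {1..n}. slot c k = j \<and> slot r (\<sigma> k) = i}"
      by (rule rev_image_eqI) (simp add: permutes_inverses(1)[OF \<sigma>])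
  qed
  have "bij_betw \<Phi> (gridded_with_counts M n A) (F \<times> H)"
    unfolding bij_betw_def
  proof (intro conjI equalityI subsetI)
    show "inj_on \<Phi> (gridded_with_counts M n A)"
    proof (rule inj_onI)
      fix s s' assume asm: "s \<in> gridded_with_counts M n A" "s' \<in> gridded_with_counts M n A" "\<Phi> s = \<Phi> s'"
      obtain \<sigma> c1 r1 \<tau> c2 r2 where s: "s = (\<sigma>, c1, r1)" "s' = (\<tau>, c2, r2)"
        by (metis prod_cases3)
      note g = gridded[OF asm(1)[unfolded s]] gridded[OF asm(2)[unfolded s]]
      have same_row: "slot r (\<sigma> k) = slot r (\<tau> k)" if "k \<in> {1..n}" for k
        using asm(3) that by (auto simp: \<Phi>_def s restrict_def fun_eq_iff split: if_splits)
      have same_col: "slot c (inv_into UNIV \<sigma> k) = slot c (inv_into UNIV \<tau> k)" if "k \<in> {1..n}" for k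
        using asm(3) that by (auto simp: \<Phi>_def s restrict_def fun_eq_iff split: if_splits)
      have \<sigma>: "\<sigma> permutes {1..n}" and \<tau>: "\<tau> permutes {1..n}" using g by auto
      have "\<sigma> k = \<tau> k" for k
      proof (cases "k \<in> {1..n}")
        case True
        define i j where "i = slot r (\<sigma> k)" and "j = slot c k"
        define P where "P = {k \<in> {1..n}. slot c k = j \<and> slot r (\<sigma> k) = i}"
        have "\<sigma> k \<in> {1..n}"
          using permutes_in_image[OF \<sigma>] True by blast
        then have ij: "i < u" "j < t"
          using slot_eq_iff(1)[OF r] slot_eq_iff(1)[OF c True] by (simp_all add: i_def j_def)
        have P': "P = {k \<in> {1..n}. slot c k = j \<and> slot r (\<tau> k) = i}"
          using same_row unfolding P_def by auto
        have "fits_cell (M $$ (i, j)) \<sigma> P"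
          unfolding P_def using g(1) ij by blast
        moreover have "fits_cell (M $$ (i, j)) \<tau> P"
          unfolding P' using g(2) ij by blast
        moreover have "\<sigma> ` P = \<tau> ` P"
        proof -
          have "\<sigma> ` P = {v \<in> {1..n}. slot r v = i \<and> slot c (inv_into UNIV \<sigma> v) = j}"
            unfolding P_def by (rule image_fibre[OF \<sigma>])
          also have "\<dots> = {v \<in> {1..n}. slot r v = i \<and> slot c (inv_into UNIV \<tau> v) = j}"
            using same_col by auto
          also have "\<dots> = \<tau> ` P"
            unfolding P' by (rule image_fibre[OF \<tau>, symmetric])
          finally show ?thesis .
        qed
        moreover have "k \<in> P" using True by (simp add: P_def i_def j_def)
        moreover have "finite P" by (simp add: P_def)
        ultimately show ?thesis by (intro fits_cell_unique)
      next
        case False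
        then show ?thesis using \<sigma> \<tau> by (metis permutes_not_in)
      qed
      then show "s = s'" using g unfolding s by auto
    qed
  next
    fix y assume "y \<in> \<Phi> ` gridded_with_counts M n A"
    then obtain \<sigma> c' r' where s: "(\<sigma>, c', r') \<in> gridded_with_counts M n A" "y = \<Phi> (\<sigma>, c', r')"
      by auto
    note g = gridded[OF s(1)]
    then have \<sigma>: "\<sigma> permutes {1..n}" by auto
    have \<sigma>_in: "\<sigma> k \<in> {1..n}" "inv_into UNIV \<sigma> k \<in> {1..n}" if "k \<in> {1..n}" for k
      using permutes_in_image[OF \<sigma>] permutes_in_image[OF permutes_inv[OF \<sigma>]] that by blast+
    have cardQ: "card {v \<in> {1..n}. slot r v = i \<and> slot c (inv_into UNIV \<sigma> v) = j} = A (i, j)" if "i < u" "j < t" for i j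
      using g that unfolding image_fibre[OF \<sigma>, symmetric]
      by (subst card_image) (auto intro: inj_on_subset[OF permutes_inj_on[OF \<sigma>]])
    have "restrict (\<lambda>k. slot r (\<sigma> k)) {1..n} \<in> F"
      unfolding F_iff using g slot_eq_iff(1)[OF r] \<sigma>_in
      by (auto cong: conj_cong simp del: atLeastAtMost_iff)
    moreover have "restrict (\<lambda>v. slot c (inv_into UNIV \<sigma> v)) {1..n} \<in> H"
      unfolding H_iff using cardQ slot_eq_iff(1)[OF c] \<sigma>_in
      by (auto cong: conj_cong simp del: atLeastAtMost_iff)
    ultimately show "y \<in> F \<times> H" unfolding s by (simp add: \<Phi>_def)
  next
    fix y assume "y \<in> F \<times> H"
    then obtain f h where y: "y = (f, h)" and f: "f \<in> F" and h: "h \<in> H" by auto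
    define P where "P = (\<lambda>(i, j). {k \<in> {1..n}. slot c k = j \<and> f k = i})"
    define Q where "Q = (\<lambda>(i, j). {v \<in> {1..n}. slot r v = i \<and> h v = j})"
    have "\<exists>m. bij_betw m (P p) (Q p) \<and> fits_cell (M $$ p) m (P p)" if p: "p \<in> positions M" for p
    proof (rule ex_bij_betw_fits_cell)
      show fin: "finite (P p)" "finite (Q p)" by (auto simp: P_def Q_def split: prod.split)
      have card: "card (P p) = A p" "card (Q p) = A p"
        using p f h by (auto simp: P_def Q_def F_iff H_iff pos)
      then show "card (P p) = card (Q p)" by simp
      show "P p = {}" if "M $$ p = Blank"
        using card(1) fin(1) blank[OF p that] by simp
    qed
    then obtain m where m: "\<And>p. p \<in> positions M \<Longrightarrow> bij_betw (m p) (P p) (Q p)"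
      and fits: "\<And>p. p \<in> positions M \<Longrightarrow> fits_cell (M $$ p) (m p) (P p)"
      by metis
    \<comment> \<open>The point at index \<open>k\<close> has to lie in row \<open>f k\<close> and column \<open>slot c k\<close>.\<close>
    define \<sigma> where "\<sigma> = (\<lambda>k. if k \<in> {1..n} then m (f k, slot c k) k else k)"
    have cell: "(f k, slot c k) \<in> positions M" "k \<in> P (f k, slot c k)" if "k \<in> {1..n}" for k
      using that f slot_eq_iff(1)[OF c that] by (auto simp: pos F_iff P_def)
    have \<sigma>_eq: "\<sigma> k = m p k" if "k \<in> P p" for k p
      using that by (cases p) (auto simp: P_def \<sigma>_def)
    have \<sigma>_in: "\<sigma> k \<in> Q (f k, slot c k)" if "k \<in> {1..n}" for k
      using m[OF cell(1)[OF that]] cell(2)[OF that] \<sigma>_eq[OF cell(2)[OF that]]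
      by (auto simp: bij_betw_def)
    have \<sigma>_slots: "\<sigma> k \<in> {1..n}" "slot r (\<sigma> k) = f k" "h (\<sigma> k) = slot c k" if "k \<in> {1..n}" for k
      using \<sigma>_in[OF that] by (auto simp: Q_def)
    have "inj_on \<sigma> {1..n}"
    proof (rule inj_onI)
      fix k l assume kl: "k \<in> {1..n}" "l \<in> {1..n}" "\<sigma> k = \<sigma> l"
      then have same: "(f l, slot c l) = (f k, slot c k)" using \<sigma>_slots by metis
      have "l \<in> P (f k, slot c k)" using cell(2)[OF kl(2)] unfolding same .
      then show "k = l"
        using m[OF cell(1)[OF kl(1)]] cell(2)[OF kl(1)] kl(3) \<sigma>_eq
        by (metis bij_betw_inv_into_left)
    qed
    moreover have "\<sigma> ` {1..n} \<subseteq> {1..n}" using \<sigma>_slots(1) by blast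
    ultimately have "bij_betw \<sigma> {1..n} {1..n}"
      by (simp add: bij_betw_def endo_inj_surj)
    then have \<sigma>: "\<sigma> permutes {1..n}"
      by (rule bij_imp_permutes) (auto simp: \<sigma>_def)
    have cells: "cell_points (\<sigma>, c, r) p = P p" if p_in: "p \<in> positions M" for p
    proof -
      obtain i j where p: "p = (i, j)" "i < u" "j < t" using p_in by (auto simp: pos)
      show ?thesis
        unfolding p(1) cell_points_eq_slots[OF \<sigma> c r p(2,3)] P_def using \<sigma>_slots(2) by auto
    qed
    have "(\<sigma>, c, r) \<in> gridded_with_counts M n A"
    proof -
      have "fits_cell (M $$ p) \<sigma> (P p)" if "p \<in> positions M" for p
        using fits[OF that] fits_cell_cong[of "P p" \<sigma> "m p" "M $$ p"] \<sigma>_eq by blast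
      moreover have "card (P p) = A p" if "p \<in> positions M" for p
        using that f by (auto simp: P_def F_iff pos)
      ultimately show ?thesis
        using \<sigma> c r cells
        by (auto simp: gridded_with_counts_def gridded_permutations_def t_def u_def)
    qed
    moreover have "\<Phi> (\<sigma>, c, r) = y"
    proof -
      have "restrict (\<lambda>k. slot r (\<sigma> k)) {1..n} = f"
        using f \<sigma>_slots(2) by (intro extensionalityI[of _ "{1..n}"]) (auto simp: F_iff PiE_def)
      moreover have "slot c (inv_into UNIV \<sigma> v) = h v" if "v \<in> {1..n}" for v
      proof -
        have "inv_into UNIV \<sigma> v \<in> {1..n}"
          using permutes_in_image[OF permutes_inv[OF \<sigma>]] that by blast
        then show ?thesis
          using \<sigma>_slots(3)[of "inv_into UNIV \<sigma> v"] permutes_inverses(1)[OF \<sigma>] by simp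
      qed
      then have "restrict (\<lambda>v. slot c (inv_into UNIV \<sigma> v)) {1..n} = h"
        using h by (intro extensionalityI[of _ "{1..n}"]) (auto simp: H_iff PiE_def)
      ultimately show ?thesis by (simp add: \<Phi>_def y)
    qed
    ultimately show "y \<in> \<Phi> ` gridded_with_counts M n A" by (metis imageI)
  qed
  then have "card (gridded_with_counts M n A) = card F * card H"
    by (simp add: bij_betw_same_card card_cartesian_product)
  then have "card (gridded_with_counts M n A) * (\<Prod>p\<in>positions M. fact (A p))\<^sup>2 =
      (card H * (\<Prod>p\<in>positions M. fact (A p))) * (card F * (\<Prod>p\<in>positions M. fact (A p)))"
    by (simp add: power2_eq_square)
  then show ?thesis unfolding cardF cardH by (simp add: t_def u_def)
qed

section \<open>Asymptotics of the counts\<close>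

text \<open>A weak form of Stirling's formula. The lower bound compares the exponential series of \<open>m\<close> with its term
  of index \<open>m\<close>. The upper bound follows from \<open>k! \<le> (k + 1)^(k + 1) / exp k\<close>, by induction on \<open>k\<close>.\<close>

lemma fact_bounds:
  shows "xlnx m - m \<le> ln (fact m)"
    and "ln (fact m) \<le> xlnx m - m + (1 + ln (real m + 1))"
proof -
  show "xlnx m - m \<le> ln (fact m)"
  proof (cases "m = 0")
    case False
    have "real m ^ m / fact m \<le> exp m"
      using exp_ge_add_one_self sum_le_suminf[of "\<lambda>k. real m ^ k / fact k" "{m}"] summable_exp[of "real m"]
      by (simp add: exp_def field_simps)
    then have "ln (real m ^ m / fact m) \<le> m"
      using False by (simp add: ln_le_cancel_iff[symmetric, of _ "exp m"] del: ln_le_cancel_iff)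
    then show ?thesis
      using False by (simp add: ln_div ln_realpow xlnx_def)
  qed simp
  have *: "ln (fact k) \<le> xlnx (real k + 1) - k" for k :: nat
  proof (induction k)
    case (Suc k)
    have "ln ((real k + 1) / (real k + 2)) \<le> (real k + 1) / (real k + 2) - 1"
      by (intro ln_le_minus_one) auto
    then have "1 / (real k + 2) \<le> ln (real k + 2) - ln (real k + 1)"
      by (simp add: ln_div field_simps)
    then have "1 \<le> (real k + 2) * (ln (real k + 2) - ln (real k + 1))"
      by (simp add: field_simps)
    moreover have "ln (fact (Suc k)) = ln (real k + 1) + ln (fact k)"
      by (simp add: ln_mult add_ac del: of_nat_add flip: of_nat_Suc)
    ultimately show ?case
      using Suc by (simp add: xlnx_def algebra_simps del: fact_Suc)
  qed (simp add: xlnx_def)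
  show "ln (fact m) \<le> xlnx m - m + (1 + ln (real m + 1))"
  proof (cases "m = 0")
    case False
    have "ln ((real m + 1) / real m) \<le> (real m + 1) / real m - 1"
      using False by (intro ln_le_minus_one) auto
    then have "ln (real m + 1) - ln (real m) \<le> 1 / m"
      using False by (simp add: ln_div field_simps)
    then have "m * (ln (real m + 1) - ln (real m)) \<le> 1"
      using False by (simp add: field_simps)
    then show ?thesis
      using *[of m] by (simp add: xlnx_def algebra_simps)
  qed simp
qed

text \<open>In the logarithm of the product of multinomial coefficients, replace every \<open>ln (fact m)\<close> by
  \<open>xlnx m - m\<close>. The linear terms cancel, because rows, columns and cells each have total \<open>n\<close>, and the
  errors are logarithmic in \<open>n\<close>.\<close>

lemma ln_card_gridded_with_counts:
  assumes total: "(\<Sum>p\<in>positions M. A p) = n"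
    and blank: "\<And>p. p \<in> positions M \<Longrightarrow> M $$ p = Blank \<Longrightarrow> A p = 0"
  defines "u \<equiv> dim_row M" and "t \<equiv> dim_col M"
  shows "0 < card (gridded_with_counts M n A)"
    and "\<bar>ln (card (gridded_with_counts M n A)) - log_growth u t (\<lambda>p. real (A p))\<bar>
      \<le> real (u + t + 2 * (u * t)) * (1 + ln (real n + 1))"
proof -
  define N where "N = card (gridded_with_counts M n A)"
  define \<rho> \<kappa> where "\<rho> i = (\<Sum>j<t. A (i, j))" and "\<kappa> j = (\<Sum>i<u. A (i, j))" for i j
  have pos: "positions M = {..<u} \<times> {..<t}" by (simp add: positions_def u_def t_def)
  have prod: "N * (\<Prod>p\<in>positions M. fact (A p))\<^sup>2 = (\<Prod>i<u. fact (\<rho> i)) * (\<Prod>j<t. fact (\<kappa> j))"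
    using card_gridded_with_counts[OF total blank] by (simp add: N_def \<rho>_def \<kappa>_def u_def t_def)
  then have "N \<noteq> 0" by (intro notI) simp
  then show "0 < card (gridded_with_counts M n A)" by (simp add: N_def)
  define L where "L m = ln (fact m :: real)" for m
  have "real N * (\<Prod>p\<in>positions M. fact (A p))\<^sup>2 = (\<Prod>i<u. fact (\<rho> i)) * (\<Prod>j<t. fact (\<kappa> j))"
    using arg_cong[OF prod, of real] by simp
  then have "ln (real N * (\<Prod>p\<in>positions M. fact (A p))\<^sup>2) =
      ln ((\<Prod>i<u. fact (\<rho> i)) * (\<Prod>j<t. fact (\<kappa> j)))" by simp
  then have lnN: "ln (real N) + 2 * (\<Sum>p\<in>positions M. L (A p)) = (\<Sum>i<u. L (\<rho> i)) + (\<Sum>j<t. L (\<kappa> j))"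
    using \<open>N \<noteq> 0\<close>
    by (simp add: L_def ln_mult ln_realpow prod_pos ln_prod pos)
  define E where "E m = L m - (xlnx m - m)" for m :: nat
  define B where "B = 1 + ln (real n + 1)"
  have E: "0 \<le> E m" "E m \<le> B" if "m \<le> n" for m
  proof -
    show "0 \<le> E m" using fact_bounds(1)[of m] by (simp add: E_def L_def)
    have "E m \<le> 1 + ln (real m + 1)" using fact_bounds(2)[of m] by (simp add: E_def L_def)
    also have "\<dots> \<le> B" using that by (simp add: B_def)
    finally show "E m \<le> B" .
  qed
  have rows: "(\<Sum>i<u. \<rho> i) = n"
    using total by (simp add: \<rho>_def pos sum.cartesian_product)
  have cols: "(\<Sum>j<t. \<kappa> j) = n"
    using rows unfolding \<rho>_def \<kappa>_def by (subst sum.swap)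
  have le: "i < u \<Longrightarrow> \<rho> i \<le> n" "j < t \<Longrightarrow> \<kappa> j \<le> n" "p \<in> positions M \<Longrightarrow> A p \<le> n" for i j p
    using member_le_sum[of i "{..<u}" \<rho>] member_le_sum[of j "{..<t}" \<kappa>]
      member_le_sum[of p "positions M" A] rows cols total by (auto simp: pos)
  have lg: "log_growth u t (\<lambda>p. real (A p)) =
      (\<Sum>i<u. xlnx (\<rho> i)) + (\<Sum>j<t. xlnx (\<kappa> j)) - 2 * (\<Sum>p\<in>positions M. xlnx (A p))"
  proof -
    have "(\<Sum>i<u. \<Sum>j<t. xlnx (A (i, j))) = (\<Sum>p\<in>positions M. xlnx (A p))"
      by (simp add: pos sum.cartesian_product)
    moreover have "(\<Sum>j<t. \<Sum>i<u. xlnx (A (i, j))) = (\<Sum>i<u. \<Sum>j<t. xlnx (A (i, j)))"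
      by (rule sum.swap)
    ultimately show ?thesis
      by (simp add: log_growth_def mixing_entropy_def \<rho>_def \<kappa>_def sum_subtractf)
  qed
  have "(\<Sum>i<u. real (\<rho> i)) = n" "(\<Sum>j<t. real (\<kappa> j)) = n" "(\<Sum>p\<in>positions M. real (A p)) = n"
    using rows cols total by (simp_all flip: of_nat_sum)
  then have err: "ln (real N) - log_growth u t (\<lambda>p. real (A p)) =
      (\<Sum>i<u. E (\<rho> i)) + (\<Sum>j<t. E (\<kappa> j)) - 2 * (\<Sum>p\<in>positions M. E (A p))"
    using lnN unfolding lg E_def by (simp add: sum_subtractf sum.distrib algebra_simps)
  have bounds: "0 \<le> (\<Sum>i<u. E (\<rho> i))" "(\<Sum>i<u. E (\<rho> i)) \<le> u * B"
    "0 \<le> (\<Sum>j<t. E (\<kappa> j))" "(\<Sum>j<t. E (\<kappa> j)) \<le> t * B"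
    "0 \<le> (\<Sum>p\<in>positions M. E (A p))" "(\<Sum>p\<in>positions M. E (A p)) \<le> (u * t) * B"
    using sum_bounded_above[of "{..<u}" "\<lambda>i. E (\<rho> i)" B] sum_bounded_above[of "{..<t}" "\<lambda>i. E (\<kappa> i)" B]
      sum_bounded_above[of "positions M" "\<lambda>p. E (A p)" B] E le
    by (auto simp: pos intro!: sum_nonneg)
  have "0 \<le> B" by (simp add: B_def)
  then have nn: "0 \<le> real u * B" "0 \<le> real t * B" "0 \<le> real u * real t * B" by simp_all
  show "\<bar>ln (card (gridded_with_counts M n A)) - log_growth u t (\<lambda>p. real (A p))\<bar>
      \<le> real (u + t + 2 * (u * t)) * (1 + ln (real n + 1))"
    unfolding N_def[symmetric] B_def[symmetric] err
    using bounds nn by (simp add: distrib_right abs_le_iff)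
qed

text \<open>Round \<open>n * x p\<close> down in all cells but one non-blank cell \<open>p0\<close>, which takes the remaining points. It
  has to be non-blank for the counts to remain zero on blank cells.\<close>

lemma integer_approximation:
  assumes x: "distribution M x"
  obtains A :: "nat \<Rightarrow> nat \<times> nat \<Rightarrow> nat" where
    "\<And>n. (\<Sum>p\<in>positions M. A n p) = n"
    "\<And>n p. p \<in> positions M \<Longrightarrow> M $$ p = Blank \<Longrightarrow> A n p = 0"
    "\<And>p. p \<in> positions M \<Longrightarrow> (\<lambda>n. real (A n p) / real n) \<longlonglongrightarrow> x p"
proof -
  note nonneg = distributionD(1)[OF x]
  have "\<exists>p\<in>positions M. x p \<noteq> 0"
    using x by (auto simp: distribution_def intro: ccontr)
  then obtain p0 where p0: "p0 \<in> positions M" "M $$ p0 \<noteq> Blank"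
    using x by (auto simp: distribution_def)
  let ?P = "positions M - {p0}"
  define F where "F n p = nat \<lfloor>n * x p\<rfloor>" for n :: nat and p
  have F: "real (F n p) \<le> n * x p" "n * x p - 1 \<le> real (F n p)" if "p \<in> positions M" for n p
    using nonneg[OF that] by (auto simp: F_def)
  have split: "(\<Sum>p\<in>positions M. f p) = f p0 + (\<Sum>p\<in>?P. f p)" for f :: "_ \<Rightarrow> 'b :: comm_monoid_add"
    using p0 by (intro sum.remove) auto
  have rest: "(\<Sum>p\<in>?P. x p) = 1 - x p0"
    using x split[of x] by (simp add: distribution_def)
  have le: "(\<Sum>p\<in>?P. F n p) \<le> n" for n
  proof -
    have "real (\<Sum>p\<in>?P. F n p) = (\<Sum>p\<in>?P. real (F n p))"
      by simp
    also have "\<dots> \<le> (\<Sum>p\<in>?P. n * x p)"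
      using F by (intro sum_mono) auto
    also have "\<dots> = n * (1 - x p0)" by (simp add: rest flip: sum_distrib_left)
    also have "\<dots> \<le> n" using nonneg[OF p0(1)] by (simp add: mult_left_le)
    finally show ?thesis by (simp only: of_nat_le_iff)
  qed
  define A where "A n p = (if p = p0 then n - (\<Sum>p\<in>?P. F n p) else F n p)" for n p
  have lim: "(\<lambda>n. real (F n p) / real n) \<longlonglongrightarrow> x p" if p: "p \<in> positions M" for p
  proof (rule tendsto_sandwich)
    have "x p - 1 / real n \<le> real (F n p) / real n" if "0 < n" for n
      using divide_right_mono[OF F(2)[OF p, of n], of "real n"] that by (simp add: diff_divide_distrib)
    then show "\<forall>\<^sub>F n in sequentially. x p - 1 / real n \<le> real (F n p) / real n"
      by (rule eventually_mono[OF eventually_gt_at_top])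
    show "\<forall>\<^sub>F n in sequentially. real (F n p) / real n \<le> x p"
      using eventually_gt_at_top[of 0] by eventually_elim (use F[OF p] in \<open>simp add: field_simps\<close>)
    show "(\<lambda>n. x p - 1 / real n) \<longlonglongrightarrow> x p"
      using tendsto_diff[OF tendsto_const lim_1_over_n, of "x p"] by simp
  qed simp
  show ?thesis
  proof (rule that[of A])
    show "(\<Sum>p\<in>positions M. A n p) = n" for n
      using le[of n] by (simp add: split A_def)
    show "A n p = 0" if "p \<in> positions M" "M $$ p = Blank" for n p
      using that p0 distributionD(2)[OF x that] by (auto simp: A_def F_def)
    show "(\<lambda>n. real (A n p) / real n) \<longlonglongrightarrow> x p" if p: "p \<in> positions M" for p
    proof (cases "p = p0")
      case True
      have "(\<lambda>n. 1 - (\<Sum>q\<in>?P. real (F n q) / real n)) \<longlonglongrightarrow> 1 - (\<Sum>q\<in>?P. x q)"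
        using lim by (intro tendsto_intros) auto
      moreover have "\<forall>\<^sub>F n in sequentially.
          1 - (\<Sum>q\<in>?P. real (F n q) / real n) = real (A n p) / real n"
        using eventually_gt_at_top[of 0]
        by eventually_elim
          (use le True in \<open>simp add: A_def of_nat_diff field_simps flip: sum_divide_distrib of_nat_sum\<close>)
      ultimately show ?thesis
        using True rest by (simp add: tendsto_cong)
    next
      case False
      then show ?thesis using lim[OF p] by (simp add: A_def)
    qed
  qed
qed

section \<open>Concentration\<close>

text \<open>A bound for the logarithm of the polynomial factor between \<open>exp (n * G (A / n))\<close> and the number of gridded
  permutations with cell counts \<open>A\<close>, where \<open>G\<close> is \<open>matrix_log_growth M\<close>.\<close>

definition count_error :: "gridding_matrix \<Rightarrow> nat \<Rightarrow> real" where
  "count_error M n = real (dim_row M + dim_col M + 2 * (dim_row M * dim_col M)) * (1 + ln (real n + 1))"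

lemma card_gridded_with_counts_bounds:
  assumes n: "0 < n" and total: "(\<Sum>p\<in>positions M. A p) = n"
    and blank: "\<And>p. p \<in> positions M \<Longrightarrow> M $$ p = Blank \<Longrightarrow> A p = 0"
  defines "x \<equiv> \<lambda>p. real (A p) / real n"
  shows "distribution M x"
    and "exp (n * matrix_log_growth M x - count_error M n) \<le> card (gridded_with_counts M n A)"
    and "card (gridded_with_counts M n A) \<le> exp (n * matrix_log_growth M x + count_error M n)"
proof -
  have "(\<Sum>p\<in>positions M. x p) = real (\<Sum>p\<in>positions M. A p) / n"
    by (simp add: x_def sum_divide_distrib)
  then show "distribution M x"
    using n blank by (auto simp: distribution_def x_def total)
  have "log_growth (dim_row M) (dim_col M) (\<lambda>p. real n * x p) = real n * matrix_log_growth M x"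
    using n by (intro log_growth_scale) (auto simp: x_def)
  then have eq: "matrix_log_growth M (\<lambda>p. real (A p)) = n * matrix_log_growth M x"
    using n by (simp add: x_def)
  note card = ln_card_gridded_with_counts[OF total blank]
  note bound = card(2)[unfolded eq, folded count_error_def]
  have "exp (ln (real (card (gridded_with_counts M n A)))) = card (gridded_with_counts M n A)"
    using card(1) by simp
  moreover have "exp (n * matrix_log_growth M x - count_error M n) \<le>
      exp (ln (real (card (gridded_with_counts M n A))))"
    "exp (ln (real (card (gridded_with_counts M n A)))) \<le>
      exp (n * matrix_log_growth M x + count_error M n)"
    using bound unfolding exp_le_cancel_iff by linarith+
  ultimately show "exp (n * matrix_log_growth M x - count_error M n) \<le> card (gridded_with_counts M n A)"
    "card (gridded_with_counts M n A) \<le> exp (n * matrix_log_growth M x + count_error M n)"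
    by linarith+
qed

text \<open>There are at most \<open>n + 1\<close> possible counts for each cell, hence polynomially many count matrices,
  and each deviating one contributes at most \<open>exp (n * H)\<close> up to the usual error.\<close>

lemma card_deviating_le:
  assumes n: "0 < n"
    and gap: "\<And>x p. distribution M x \<Longrightarrow> p \<in> positions M \<Longrightarrow> \<bar>x p - \<gamma> p\<bar> > \<epsilon> \<Longrightarrow>
      matrix_log_growth M x \<le> H"
  shows "card {s \<in> gridded_permutations M n.
      \<exists>p\<in>positions M. \<bar>real (card (cell_points s p)) / real n - \<gamma> p\<bar> > \<epsilon>}
    \<le> (real n + 1) ^ (dim_row M * dim_col M) * exp (n * H + count_error M n)" (is "real (card ?bad) \<le> _")
proof -
  define \<A> where "\<A> = {A \<in> positions M \<rightarrow>\<^sub>E {..n}. (\<Sum>p\<in>positions M. A p) = n \<and>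
    (\<forall>p\<in>positions M. M $$ p = Blank \<longrightarrow> A p = 0) \<and>
    (\<exists>p\<in>positions M. \<bar>real (A p) / real n - \<gamma> p\<bar> > \<epsilon>)}"
  have sub: "\<A> \<subseteq> positions M \<rightarrow>\<^sub>E {..n}" by (auto simp: \<A>_def)
  then have fin: "finite \<A>" by (rule finite_subset) (simp add: finite_PiE)
  have "card \<A> \<le> card (positions M \<rightarrow>\<^sub>E {..n})"
    using sub by (intro card_mono) (simp_all add: finite_PiE)
  also have "\<dots> = (n + 1) ^ (dim_row M * dim_col M)"
    by (simp add: card_PiE positions_def)
  finally have "real (card \<A>) \<le> real ((n + 1) ^ (dim_row M * dim_col M))"
    by (simp only: of_nat_le_iff)
  then have card\<A>: "real (card \<A>) \<le> (real n + 1) ^ (dim_row M * dim_col M)"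
    by (simp add: add.commute)
  have "?bad \<subseteq> (\<Union>A\<in>\<A>. gridded_with_counts M n A)"
  proof
    fix s assume s: "s \<in> ?bad"
    obtain \<sigma> c r where s_eq: "s = (\<sigma>, c, r)" by (cases s)
    have mem: "(\<sigma>, c, r) \<in> gridded_permutations M n" using s by (simp add: s_eq)
    define A where "A = restrict (\<lambda>p. card (cell_points s p)) (positions M)"
    have total: "(\<Sum>p\<in>positions M. A p) = n"
      using gridded_counts(3)[OF mem] by (simp add: A_def s_eq)
    have "A p \<le> n" if "p \<in> positions M" for p
      using member_le_sum[of p "positions M" A] that total by simp
    moreover have "A p = 0" if p: "p \<in> positions M" "M $$ p = Blank" for p
    proof -
      have "fits_cell (M $$ p) \<sigma> (cell_points (\<sigma>, c, r) p)"
        using mem p(1) by (auto simp: gridded_permutations_def)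
      then show ?thesis using p by (simp add: A_def s_eq)
    qed
    moreover have "\<exists>p\<in>positions M. \<bar>real (A p) / real n - \<gamma> p\<bar> > \<epsilon>"
      using s by (auto simp: A_def)
    moreover have "A \<in> extensional (positions M)" by (simp add: A_def)
    ultimately have "A \<in> \<A>" using total by (auto simp: \<A>_def PiE_def)
    moreover have "s \<in> gridded_with_counts M n A"
      using s by (simp add: gridded_with_counts_def A_def)
    ultimately show "s \<in> (\<Union>A\<in>\<A>. gridded_with_counts M n A)" by blast
  qed
  then have "card ?bad \<le> card (\<Union>A\<in>\<A>. gridded_with_counts M n A)"
    using fin finite_gridded_permutations by (intro card_mono) (auto simp: gridded_with_counts_def)
  also have "\<dots> \<le> (\<Sum>A\<in>\<A>. card (gridded_with_counts M n A))"
    using fin by (rule card_UN_le)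
  finally have "real (card ?bad) \<le> real (\<Sum>A\<in>\<A>. card (gridded_with_counts M n A))"
    by (simp only: of_nat_le_iff)
  also have "\<dots> = (\<Sum>A\<in>\<A>. real (card (gridded_with_counts M n A)))"
    by (rule of_nat_sum)
  also have "\<dots> \<le> (\<Sum>A\<in>\<A>. exp (n * H + count_error M n))"
  proof (rule sum_mono)
    fix A assume A: "A \<in> \<A>"
    then have total: "(\<Sum>p\<in>positions M. A p) = n"
      and blank: "\<And>p. p \<in> positions M \<Longrightarrow> M $$ p = Blank \<Longrightarrow> A p = 0"
      by (auto simp: \<A>_def)
    note bounds = card_gridded_with_counts_bounds[OF n total blank]
    obtain p where "p \<in> positions M" "\<bar>real (A p) / real n - \<gamma> p\<bar> > \<epsilon>"
      using A by (auto simp: \<A>_def)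
    then have "matrix_log_growth M (\<lambda>p. real (A p) / real n) \<le> H"
      by (intro gap[OF bounds(1)])
    then have "exp (n * matrix_log_growth M (\<lambda>p. real (A p) / real n) + count_error M n)
        \<le> exp (n * H + count_error M n)"
      by (simp add: mult_left_mono)
    then show "real (card (gridded_with_counts M n A)) \<le> exp (n * H + count_error M n)"
      using bounds(3) by linarith
  qed
  also have "\<dots> = card \<A> * exp (n * H + count_error M n)" by simp
  also have "\<dots> \<le> (real n + 1) ^ (dim_row M * dim_col M) * exp (n * H + count_error M n)"
    using card\<A> by (intro mult_right_mono) auto
  finally show ?thesis .
qed

lemma exp_log_minus_linear_tendsto_0:
  fixes a b d :: real
  assumes "0 < d"
  shows "(\<lambda>n. exp (a * ln (real n + 1) + b - n * d)) \<longlonglongrightarrow> 0"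
  using assms by real_asymp

theorem theorem3p8:
  fixes M :: gridding_matrix and \<Gamma> :: "real mat" and \<epsilon> :: real
  assumes "connected_gridding_matrix M"
    and "maximal_distribution_matrix M \<Gamma>"
    and "\<epsilon> > 0"
  shows "(\<lambda>n. measure_pmf.prob (pmf_of_set (gridded_permutations M n))
            {s. Max ((\<lambda>p. \<bar>real (card (cell_points s p)) / real n - \<Gamma> $$ p\<bar>) ` positions M) \<le> \<epsilon>})
         \<longlonglongrightarrow> 1"
proof -
  define G where "G = matrix_log_growth M (($$) \<Gamma>)"
  define S where "S n = gridded_permutations M n" for n
  define bad where "bad n = {s \<in> S n. \<exists>p\<in>positions M. \<bar>real (card (cell_points s p)) / real n - \<Gamma> $$ p\<bar> > \<epsilon>}" for n
  have bad_eq: "bad n = {s \<in> S n. \<not> (\<forall>p\<in>positions M. \<bar>real (card (cell_points s p)) / real n - \<Gamma> $$ p\<bar> \<le> \<epsilon>)}" for n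
    by (simp add: bad_def not_le)
  have max: "maximal_distribution M (($$) \<Gamma>)"
    by (rule maximal_distribution_of_matrix[OF assms(2)])
  then have \<Gamma>: "distribution M (($$) \<Gamma>)" by (simp add: maximal_distribution_def)
  then have nonempty: "positions M \<noteq> {}" by (auto simp: distribution_def)
  then have Max_le: "Max (f ` positions M) \<le> \<epsilon> \<longleftrightarrow> (\<forall>p\<in>positions M. f p \<le> \<epsilon>)" for f :: "_ \<Rightarrow> real"
    by simp
  have S: "finite (S n)" "S n \<noteq> {}" for n
    unfolding S_def by (intro finite_gridded_permutations gridded_permutations_nonempty assms)+
  have prob: "measure_pmf.prob (pmf_of_set (gridded_permutations M n))
      {s. Max ((\<lambda>p. \<bar>real (card (cell_points s p)) / real n - \<Gamma> $$ p\<bar>) ` positions M) \<le> \<epsilon>}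
    = 1 - card (bad n) / card (S n)" for n
  proof -
    have "S n \<inter> {s. Max ((\<lambda>p. \<bar>real (card (cell_points s p)) / real n - \<Gamma> $$ p\<bar>) ` positions M) \<le> \<epsilon>}
        = S n - bad n"
      unfolding bad_eq Max_le by blast
    moreover have "card (S n - bad n) = card (S n) - card (bad n)" "card (bad n) \<le> card (S n)"
      using S by (auto simp: bad_def intro!: card_Diff_subset card_mono)
    moreover have "card (S n) \<noteq> 0" using S by simp
    ultimately show ?thesis
      using S unfolding S_def[symmetric]
      by (simp add: measure_pmf_of_set of_nat_diff diff_divide_distrib)
  qed
  obtain \<delta> where \<delta>: "0 < \<delta>"
    and gap: "\<And>x p. distribution M x \<Longrightarrow> p \<in> positions M \<Longrightarrow> \<bar>x p - \<Gamma> $$ p\<bar> > \<epsilon> \<Longrightarrow>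
      matrix_log_growth M x \<le> G - \<delta>"
    unfolding G_def using growth_gap[OF assms(1) max assms(3)] by blast
  obtain A where A: "\<And>n. (\<Sum>p\<in>positions M. A n p) = n"
    "\<And>n p. p \<in> positions M \<Longrightarrow> M $$ p = Blank \<Longrightarrow> A n p = 0"
    "\<And>p. p \<in> positions M \<Longrightarrow> (\<lambda>n. real (A n p) / real n) \<longlonglongrightarrow> \<Gamma> $$ p"
    using integer_approximation[OF \<Gamma>] by blast
  have "(\<lambda>n. matrix_log_growth M (\<lambda>p. real (A n p) / real n)) \<longlonglongrightarrow> G"
    unfolding G_def using A(3) by (intro tendsto_log_growth) (auto simp: positions_def)
  then have near: "\<forall>\<^sub>F n in sequentially. G - \<delta> / 2 < matrix_log_growth M (\<lambda>p. real (A n p) / real n)"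
    using \<delta> by (intro order_tendstoD(1)) auto
  define m K where "m = dim_row M * dim_col M"
    and "K = real (dim_row M + dim_col M + 2 * (dim_row M * dim_col M))"
  have ratio_le: "\<forall>\<^sub>F n in sequentially. real (card (bad n)) / card (S n) \<le>
      exp ((m + 2 * K) * ln (real n + 1) + 2 * K - n * (\<delta> / 2))"
    using near eventually_gt_at_top[of 0]
  proof eventually_elim
    case (elim n)
    define E where "E = count_error M n"
    have E: "E = K * (1 + ln (real n + 1))"
      by (simp only: E_def count_error_def K_def)
    have "real (card (bad n)) \<le> (real n + 1) ^ m * exp (n * (G - \<delta>) + E)"
      unfolding bad_def S_def m_def E_def by (rule card_deviating_le[OF elim(2) gap])
    also have "(real n + 1) ^ m = exp (m * ln (real n + 1))"
      by (simp add: exp_of_nat_mult)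
    finally have upper: "real (card (bad n)) \<le> exp (m * ln (real n + 1) + (n * (G - \<delta>) + E))"
      by (simp add: exp_add)
    have "n * (G - \<delta> / 2) \<le> n * matrix_log_growth M (\<lambda>p. real (A n p) / real n)"
      using elim by (intro mult_left_mono) auto
    then have "exp (n * (G - \<delta> / 2) - E) \<le>
        exp (n * matrix_log_growth M (\<lambda>p. real (A n p) / real n) - E)" by simp
    also have "\<dots> \<le> card (gridded_with_counts M n (A n))"
      unfolding E_def by (rule card_gridded_with_counts_bounds(2)[OF elim(2) A(1,2)])
    also have "\<dots> \<le> card (S n)"
      using S(1) by (auto simp: S_def gridded_with_counts_def intro!: card_mono)
    finally have lower: "exp (n * (G - \<delta> / 2) - E) \<le> card (S n)" .
    \<comment> \<open>The gap \<open>\<delta>\<close> above beats the loss \<open>\<delta> / 2\<close> below, with \<open>\<delta> / 2\<close> to spare in the exponent.\<close>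
    have "real (card (bad n)) / card (S n) \<le>
        exp (m * ln (real n + 1) + (n * (G - \<delta>) + E)) / exp (n * (G - \<delta> / 2) - E)"
      using upper lower by (intro frac_le) auto
    also have "\<dots> = exp ((m + 2 * K) * ln (real n + 1) + 2 * K - n * (\<delta> / 2))"
      by (simp add: E algebra_simps flip: exp_diff)
    finally show ?case .
  qed
  have lim0: "(\<lambda>n. exp ((m + 2 * K) * ln (real n + 1) + 2 * K - n * (\<delta> / 2))) \<longlonglongrightarrow> 0"
    using \<delta> by (intro exp_log_minus_linear_tendsto_0) simp
  have "(\<lambda>n. real (card (bad n)) / card (S n)) \<longlonglongrightarrow> 0"
    by (rule tendsto_sandwich[OF _ ratio_le tendsto_const lim0]) simp
  from tendsto_diff[OF tendsto_const[of 1] this] show ?thesis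
    by (simp add: prob)
qed

end
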